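(* Each of the seven matroids $\mathcal{F}_7^{-4}$, $\mathcal{W}^{3+}$, $\mathcal{W}^3+e$, $\mathcal{P}'_7$, $n\mathcal{P}\smallsetminus 1$, $n\mathcal{P}\smallsetminus 9$, and the Vámos cube $\mathcal{V}_8$ has the half-plane property, and equivalently has the strong Rayleigh property; that is, for each of these matroids $\mathcal{M}$, the basis-generating polynomial $M(\mathbf{y})=\sum_B\prod_{e\in B}y_e$ (sum over all bases $B$ of $\mathcal{M}$) satisfies: (i) $M(\mathbf{y})\neq 0$ whenever all $y_e\in\mathbb{C}$ satisfy $\mathrm{Re}(y_e)>0$; and (ii) for all distinct elements $e,f$ of the ground set and all real values of the variables, $$\frac{\partial M}{\partial y_e}\,\frac{\partial M}{\partial y_f}-\frac{\partial^2 M}{\partial y_e\,\partial y_f}\,M\ \ge\ 0.$$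
   Context: A matroid $\mathcal{M}$ has the half-plane property if its basis-generating polynomial satisfies (i), and the strong Rayleigh property if its basis-generating polynomial satisfies (ii). (The basis-generating polynomial is homogeneous and multiaffine.) The matroids, specified up to isomorphism by their bases: - $\mathcal{F}_7^{-4}$: ground set $\{1,\dots,7\}$, rank $3$; the bases are all $3$-element subsets except $\{1,2,3\},\{1,4,7\},\{1,5,6\}$. - $\mathcal{W}^{3+}$: ground set $\{1,\dots,7\}$, rank $3$; the bases are all $3$-element subsets except the four $3$-element subsets of $\{1,2,3,7\}$ and the sets $\{1,5,6\},\{3,4,5\}$. - $\mathcal{W}^3+e$: ground set $\{1,\dots,7\}$, rank $3$; the bases are all $3$-element subsets except $\{1,2,3\},\{1,5,6\},\{3,4,5\}$. - $\mathcal{P}'_7$: ground set $\{1,\dots,7\}$, rank $3$; the bases are all $3$-element subsets except $\{1,2,3\},\{1,5,6\},\{2,6,7\},\{3,4,5\}$. - The non-Pappus matroid $n\mathcal{P}$: ground set $\{1,\dots,9\}$, rank $3$; the bases are all $3$-element subsets except $\{1,2,3\},\{4,5,6\},\{1,5,7\},\{2,4,7\},\{1,6,8\},\{3,4,8\},\{2,6,9\},\{3,5,9\}$ (in particular $\{7,8,9\}$ is a basis). $n\mathcal{P}\smallsetminus 1$ and $n\mathcal{P}\smallsetminus 9$ are the matroids obtained by deleting the element $1$, respectively $9$; their bases are the bases of $n\mathcal{P}$ not containing that element. - The Vámos cube $\mathcal{V}_8$: ground set $\{1,\dots,8\}$, rank $4$; the bases are all $4$-element subsets except $\{1,2,3,4\},\{1,3,5,6\},\{2,4,5,6\},\{1,3,7,8\},\{2,4,7,8\}$.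 *)

theory Defs
  imports "HOL-Analysis.Analysis"
begin

section \<open>Matroids given by their bases\<close>

record 'a basis_system =
  ground :: "'a set"
  bases :: "'a set set"

definition matroid :: "'a basis_system \<Rightarrow> bool" where
  "matroid M \<longleftrightarrow>
     finite (ground M) \<and> bases M \<noteq> {} \<and> (\<forall>B\<in>bases M. B \<subseteq> ground M) \<and>
     (\<forall>A\<in>bases M. \<forall>B\<in>bases M. \<forall>x\<in>A - B. \<exists>y\<in>B - A. insert y (A - {x}) \<in> bases M)"

text \<open>For a matroid this is the deletion of \<open>e\<close> provided that some basis avoids \<open>e\<close>,
  that is, provided that \<open>e\<close> is not a coloop; see \<open>matroid_delete\<close> below.\<close>

definition delete :: "'a basis_system \<Rightarrow> 'a \<Rightarrow> 'a basis_system" where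
  "delete M e = \<lparr>ground = ground M - {e}, bases = {B \<in> bases M. e \<notin> B}\<rparr>"


section \<open>Basis-generating polynomial, half-plane property, strong Rayleigh property\<close>

text \<open>Polynomials are represented by their evaluation maps. Variables are indexed by the whole
  type, but only those indexed by the ground set occur.\<close>

definition basis_poly :: "'a basis_system \<Rightarrow> ('a \<Rightarrow> 'b::comm_semiring_1) \<Rightarrow> 'b" where
  "basis_poly M y = (\<Sum>B\<in>bases M. \<Prod>e\<in>B. y e)"

definition partial_deriv :: "'a \<Rightarrow> (('a \<Rightarrow> real) \<Rightarrow> real) \<Rightarrow> ('a \<Rightarrow> real) \<Rightarrow> real" where
  "partial_deriv e F y = deriv (\<lambda>t. F (y(e := t))) (y e)"

definition half_plane_property :: "'a basis_system \<Rightarrow> bool" where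
  "half_plane_property M \<longleftrightarrow>
     (\<forall>y :: 'a \<Rightarrow> complex. (\<forall>e\<in>ground M. Re (y e) > 0) \<longrightarrow> basis_poly M y \<noteq> 0)"

definition strong_Rayleigh_property :: "'a basis_system \<Rightarrow> bool" where
  "strong_Rayleigh_property M \<longleftrightarrow>
     (\<forall>e\<in>ground M. \<forall>f\<in>ground M. e \<noteq> f \<longrightarrow>
       (\<forall>y :: 'a \<Rightarrow> real.
          partial_deriv e (basis_poly M) y * partial_deriv f (basis_poly M) y
          - partial_deriv e (partial_deriv f (basis_poly M)) y * basis_poly M y \<ge> 0))"


section \<open>The matroids\<close>

definition from_nonbases :: "nat \<Rightarrow> nat \<Rightarrow> nat set set \<Rightarrow> nat basis_system" where
  "from_nonbases n r N =
     \<lparr>ground = {1..n}, bases = {B. B \<subseteq> {1..n} \<and> card B = r \<and> B \<notin> N}\<rparr>"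

definition F7_minus4 :: "nat basis_system" where
  "F7_minus4 = from_nonbases 7 3 {{1,2,3}, {1,4,7}, {1,5,6}}"

definition W3_plus :: "nat basis_system" where
  "W3_plus = from_nonbases 7 3 ({S. S \<subseteq> {1,2,3,7} \<and> card S = 3} \<union> {{1,5,6}, {3,4,5}})"

definition W3_plus_e :: "nat basis_system" where
  "W3_plus_e = from_nonbases 7 3 {{1,2,3}, {1,5,6}, {3,4,5}}"

definition P7_prime :: "nat basis_system" where
  "P7_prime = from_nonbases 7 3 {{1,2,3}, {1,5,6}, {2,6,7}, {3,4,5}}"

definition non_Pappus :: "nat basis_system" where
  "non_Pappus = from_nonbases 9 3
     {{1,2,3}, {4,5,6}, {1,5,7}, {2,4,7}, {1,6,8}, {3,4,8}, {2,6,9}, {3,5,9}}"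

definition Vamos_cube :: "nat basis_system" where
  "Vamos_cube = from_nonbases 8 4
     {{1,2,3,4}, {1,3,5,6}, {2,4,5,6}, {1,3,7,8}, {2,4,7,8}}"


section \<open>These basis systems are matroids\<close>

lemma matroid_delete:
  assumes M: "matroid M" and B0: "B0 \<in> bases M" "e \<notin> B0"
  shows "matroid (delete M e)"
proof -
  have bases: "B \<in> bases (delete M e) \<longleftrightarrow> B \<in> bases M \<and> e \<notin> B" for B
    by (simp add: delete_def)
  have ground: "ground (delete M e) = ground M - {e}" by (simp add: delete_def)
  show ?thesis
    unfolding matroid_def
  proof (intro conjI ballI)
    show "finite (ground (delete M e))" using M by (simp add: ground matroid_def)
    show "bases (delete M e) \<noteq> {}" using B0 bases by blast
    show "B \<subseteq> ground (delete M e)" if "B \<in> bases (delete M e)" for B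
      using that M unfolding bases ground matroid_def by blast
    show "\<exists>y\<in>B - A. insert y (A - {x}) \<in> bases (delete M e)"
      if "A \<in> bases (delete M e)" "B \<in> bases (delete M e)" "x \<in> A - B" for A B x
    proof -
      have "A \<in> bases M" "B \<in> bases M" using that bases by blast+
      with M that(3) obtain y where "y \<in> B - A" "insert y (A - {x}) \<in> bases M"
        unfolding matroid_def by blast
      with that show ?thesis unfolding bases by blast
    qed
  qed
qed

lemma matroid_paving:
  assumes hyp: "\<And>H K. H \<in> \<H> \<Longrightarrow> K \<in> \<H> \<Longrightarrow> H \<noteq> K \<Longrightarrow> finite (H \<inter> K) \<and> card (H \<inter> K) + 1 < r"
    and non: "\<And>B. B \<subseteq> {1..n} \<Longrightarrow> card B = r \<Longrightarrow> B \<in> N \<longleftrightarrow> (\<exists>H\<in>\<H>. B \<subseteq> H)"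
    and ex: "B0 \<subseteq> {1..n}" "card B0 = r" "B0 \<notin> N"
  shows "matroid (from_nonbases n r N)"
proof -
  have exch: "\<exists>y\<in>B - A. insert y (A - {x}) \<subseteq> {1..n} \<and> card (insert y (A - {x})) = r
      \<and> insert y (A - {x}) \<notin> N"
    if A: "A \<subseteq> {1..n}" "card A = r" "A \<notin> N" and B: "B \<subseteq> {1..n}" "card B = r" "B \<notin> N"
      and x: "x \<in> A - B" for A B x
  proof (rule ccontr)
    assume neg: "\<not> ?thesis"
    have fin: "finite A" "finite B" using finite_subset[OF A(1)] finite_subset[OF B(1)] by simp_all
    have card': "card (insert y (A - {x})) = r" if "y \<in> B - A" for y
    proof -
      have "card (insert y (A - {x})) = Suc (card (A - {x}))" using that fin by simp
      also have "\<dots> = card A" using x fin by (intro card_Suc_Diff1) auto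
      finally show ?thesis using A(2) by simp
    qed
    have "\<exists>H\<in>\<H>. insert y (A - {x}) \<subseteq> H" if "y \<in> B - A" for y
    proof -
      have s: "insert y (A - {x}) \<subseteq> {1..n}" using that A(1) B(1) by blast
      with neg that card'[OF that] have "insert y (A - {x}) \<in> N" by blast
      with non[OF s card'[OF that]] show ?thesis by simp
    qed
    then obtain h where h: "\<And>y. y \<in> B - A \<Longrightarrow> h y \<in> \<H> \<and> insert y (A - {x}) \<subseteq> h y" by metis
    have "B - A \<noteq> {}"
    proof
      assume "B - A = {}"
      then have "B = A" using fin A(2) B(2) by (intro card_subset_eq) auto
      with x show False by blast
    qed
    then obtain z where z: "z \<in> B - A" by blast
    have "h y = h z" if y: "y \<in> B - A" for y
    proof (rule ccontr)
      assume "h y \<noteq> h z"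
      then have f: "finite (h y \<inter> h z)" "card (h y \<inter> h z) + 1 < r"
        using hyp h[OF y] h[OF z] by blast+
      have "A - {x} \<subseteq> h y \<inter> h z" using h[OF y] h[OF z] by blast
      then have "card (A - {x}) \<le> card (h y \<inter> h z)" using f by (simp add: card_mono)
      moreover have "card (A - {x}) = r - 1" using x A(2) by simp
      ultimately show False using f by linarith
    qed
    then have "B - A \<subseteq> h z" using h by blast
    moreover have "B \<inter> A \<subseteq> h z" using h[OF z] x by blast
    ultimately have "B \<subseteq> h z" by blast
    then show False using non[OF B(1,2)] B(3) h[OF z] by blast
  qed
  let ?M = "from_nonbases n r N"
  have bases: "B \<in> bases ?M \<longleftrightarrow> B \<subseteq> {1..n} \<and> card B = r \<and> B \<notin> N" for B
    by (simp add: from_nonbases_def)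
  have ground: "ground ?M = {1..n}" by (simp add: from_nonbases_def)
  show ?thesis
    unfolding matroid_def
  proof (intro conjI ballI)
    show "finite (ground ?M)" by (simp add: ground)
    show "bases ?M \<noteq> {}" using ex bases by blast
    show "B \<subseteq> ground ?M" if "B \<in> bases ?M" for B using that bases ground by blast
    show "\<exists>y\<in>B - A. insert y (A - {x}) \<in> bases ?M"
      if "A \<in> bases ?M" "B \<in> bases ?M" "x \<in> A - B" for A B x
      using that exch[of A B x] unfolding bases by blast
  qed
qed

lemma matroid_sparse_paving:
  assumes "\<And>H K. H \<in> N \<Longrightarrow> K \<in> N \<Longrightarrow> H \<noteq> K \<Longrightarrow> card (H \<inter> K) + 1 < r"
    and "\<And>H. H \<in> N \<Longrightarrow> finite H \<and> card H = r"
    and "B0 \<subseteq> {1..n}" "card B0 = r" "B0 \<notin> N"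
  shows "matroid (from_nonbases n r N)"
proof (rule matroid_paving[of N])
  show "B \<in> N \<longleftrightarrow> (\<exists>H\<in>N. B \<subseteq> H)" if "card B = r" for B
    using that assms(2) card_subset_eq by (metis subset_refl)
next
  fix H K assume "H \<in> N" "K \<in> N" "H \<noteq> K"
  then show "finite (H \<inter> K) \<and> card (H \<inter> K) + 1 < r" using assms(1,2) by blast
qed (fact assms(3-5))+

lemma matroid_F7_minus4: "matroid F7_minus4"
  unfolding F7_minus4_def
proof (rule matroid_sparse_paving[where ?B0.0 = "{1,2,4}"], goal_cases)
  case (1 H K)
  then show ?case by (elim insertE emptyE) simp_all
next
  case (2 H)
  then show ?case by (elim insertE emptyE) simp_all
qed (simp_all add: set_eq_subset)

lemma matroid_W3_plus_e: "matroid W3_plus_e"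
  unfolding W3_plus_e_def
proof (rule matroid_sparse_paving[where ?B0.0 = "{1,2,4}"], goal_cases)
  case (1 H K)
  then show ?case by (elim insertE emptyE) simp_all
next
  case (2 H)
  then show ?case by (elim insertE emptyE) simp_all
qed (simp_all add: set_eq_subset)

lemma matroid_P7_prime: "matroid P7_prime"
  unfolding P7_prime_def
proof (rule matroid_sparse_paving[where ?B0.0 = "{1,2,4}"], goal_cases)
  case (1 H K)
  then show ?case by (elim insertE emptyE) simp_all
next
  case (2 H)
  then show ?case by (elim insertE emptyE) simp_all
qed (simp_all add: set_eq_subset)

lemma matroid_Vamos_cube: "matroid Vamos_cube"
  unfolding Vamos_cube_def
proof (rule matroid_sparse_paving[where ?B0.0 = "{5,6,7,8}"], goal_cases)
  case (1 H K)
  then show ?case by (elim insertE emptyE) simp_all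
next
  case (2 H)
  then show ?case by (elim insertE emptyE) simp_all
qed (simp_all add: set_eq_subset)

lemma matroid_non_Pappus: "matroid non_Pappus"
  unfolding non_Pappus_def
proof (rule matroid_sparse_paving[where ?B0.0 = "{7,8,9}"], goal_cases)
  case (1 H K)
  then show ?case by (elim insertE emptyE) simp_all
next
  case (2 H)
  then show ?case by (elim insertE emptyE) simp_all
qed (simp_all add: set_eq_subset)

lemma matroid_W3_plus: "matroid W3_plus"
  unfolding W3_plus_def
proof (rule matroid_paving[where \<H> = "{{1,2,3,7}, {1,5,6}, {3,4,5}}" and ?B0.0 = "{4,6,7}"])
  show "B \<in> {S. S \<subseteq> {1,2,3,7} \<and> card S = 3} \<union> {{1,5,6}, {3,4,5}}
      \<longleftrightarrow> (\<exists>H\<in>{{1,2,3,7}, {1,5,6}, {3,4,5}}. B \<subseteq> H)" if "card B = 3" for B :: "nat set"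
    using that card_subset_eq[of "{1,5,6}" B] card_subset_eq[of "{3,4,5}" B] by auto
next
  fix H K :: "nat set"
  assume "H \<in> {{1,2,3,7}, {1,5,6}, {3,4,5}}" "K \<in> {{1,2,3,7}, {1,5,6}, {3,4,5}}" "H \<noteq> K"
  then show "finite (H \<inter> K) \<and> card (H \<inter> K) + 1 < 3"
    by (elim insertE emptyE) simp_all
qed (simp_all add: set_eq_subset)

lemma matroid_non_Pappus_delete:
  "matroid (delete non_Pappus 1)" "matroid (delete non_Pappus 9)"
proof -
  have "{2,3,4} \<in> bases non_Pappus"
    unfolding non_Pappus_def from_nonbases_def by (simp add: set_eq_subset)
  then show "matroid (delete non_Pappus 1)" "matroid (delete non_Pappus 9)"
    using matroid_delete[OF matroid_non_Pappus] by auto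
qed

end

theory Submission
  imports Defs "HOL-Computational_Algebra.Polynomial"
begin

text \<open>For a multiaffine polynomial \<open>F\<close> let \<open>\<Delta>\<^sub>e\<^sub>f\<close> be the Rayleigh difference of \<open>e\<close> and \<open>f\<close>. It is a quadratic
  polynomial in every other variable \<open>y\<^sub>k\<close>, whose constant and leading coefficients are the Rayleigh
  differences of \<open>e\<close> and \<open>f\<close> for the deletion and the contraction of \<open>k\<close>, and whose discriminant depends
  only on the set \<open>{e, f, k}\<close>. Hence (Wagner and Wei) all Rayleigh differences are nonnegative as soon as
  this holds for one pair and for the deletions and contractions of the two elements of that pair. This
  reduces the strong Rayleigh property to rank 2 matroids, their duals, and one explicit sum of squares
  for each matroid. By a theorem of Branden the strong Rayleigh property implies stability, which for a
  homogeneous polynomial is the half-plane property.\<close>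

subsection \<open>The Wagner-Wei criterion\<close>

text \<open>A real quadratic is nonnegative everywhere exactly when both outer coefficients are
  nonnegative and the discriminant \<open>q\<^sup>2 - 4 * p * r\<close> is at most 0. The inequality
  for \<open>{i, j}\<close> therefore fixes the sign of the discriminant in \<open>y k\<close>,
  which is also that of the difference of \<open>{i, k}\<close> in \<open>y j\<close>, and the
  minors at \<open>j\<close> give the outer coefficients there. So a pair is changed one element at
  a time, at the cost of the minors at the exchanged element. The argument depends on variables that
  range over all reals, not only over positive ones. The auxiliary rank 3 matroids with at most two
  three-point lines are there to close this recursion on minors. Duality ends it: rank 3 on five
  elements becomes rank 2, and the rank 4 deletions on seven elements become rank 3.\<close>

definition multiaffine :: "(('a \<Rightarrow> 'b::comm_ring_1) \<Rightarrow> 'b) \<Rightarrow> bool" where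
  "multiaffine F \<longleftrightarrow> (\<forall>e y. F y = F (y(e := 0)) + y e * (F (y(e := 1)) - F (y(e := 0))))"

text \<open>On basis-generating polynomials, \<open>del\<close> and \<open>con\<close> are deletion and contraction; on a multiaffine
  function \<open>con e\<close> is the partial derivative with respect to \<open>y e\<close>.\<close>

definition del :: "'a \<Rightarrow> (('a \<Rightarrow> 'b::comm_ring_1) \<Rightarrow> 'b) \<Rightarrow> ('a \<Rightarrow> 'b) \<Rightarrow> 'b" where
  "del e F y = F (y(e := 0))"

definition con :: "'a \<Rightarrow> (('a \<Rightarrow> 'b::comm_ring_1) \<Rightarrow> 'b) \<Rightarrow> ('a \<Rightarrow> 'b) \<Rightarrow> 'b" where
  "con e F y = F (y(e := 1)) - F (y(e := 0))"

text \<open>The four factors are the coefficients of \<open>F\<close> as a function of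
  \<open>y e\<close> and \<open>y f\<close>, so the inequality is free of these two variables. For
  multiaffine \<open>F\<close> it amounts to the inequality between partial derivatives, see
  \<open>multiaffine_Rayleigh_difference\<close>.\<close>

definition rayleigh_pair :: "'a \<Rightarrow> 'a \<Rightarrow> (('a \<Rightarrow> real) \<Rightarrow> real) \<Rightarrow> bool" where
  "rayleigh_pair e f F \<longleftrightarrow>
     (\<forall>y. con e (con f F) y * del e (del f F) y \<le> con e (del f F) y * con f (del e F) y)"

definition rayleigh :: "(('a \<Rightarrow> real) \<Rightarrow> real) \<Rightarrow> bool" where
  "rayleigh F \<longleftrightarrow> (\<forall>e f. e \<noteq> f \<longrightarrow> rayleigh_pair e f F)"

lemma del_con_commute:
  assumes "e \<noteq> f"
  shows "del e (del f F) = del f (del e F)" "con e (con f F) = con f (con e F)"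
    "con e (del f F) = del f (con e F)"
  using assms by (auto simp: del_def con_def fun_eq_iff fun_upd_twist)

lemma del_con_upd [simp]:
  "del e F (y(e := t)) = del e F y" "con e F (y(e := t)) = con e F y"
  by (simp_all add: del_def con_def)

lemma multiaffine_expand: "multiaffine F \<Longrightarrow> F y = del e F y + y e * con e F y"
  by (simp add: multiaffine_def del_def con_def)

lemma multiaffine_del: "multiaffine F \<Longrightarrow> multiaffine (del e F)"
  unfolding multiaffine_def
proof (intro allI)
  fix x y
  assume F: "\<forall>e y. F y = F (y(e := 0)) + y e * (F (y(e := 1)) - F (y(e := 0)))"
  show "del e F y = del e F (y(x := 0)) + y x * (del e F (y(x := 1)) - del e F (y(x := 0)))"
  proof (cases "x = e")
    case False
    then show ?thesis
      using F[rule_format, of "y(e := 0)" x] by (simp add: del_def fun_upd_twist)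
  qed simp
qed

lemma rayleigh_pair_sym: "e \<noteq> f \<Longrightarrow> rayleigh_pair e f F \<longleftrightarrow> rayleigh_pair f e F"
  by (simp add: rayleigh_pair_def del_con_commute[of e f] mult.commute)

section \<open>Real quadratics that are nonnegative everywhere\<close>

lemma quadratic_nonneg:
  fixes p q r :: real
  assumes "p \<ge> 0" "r \<ge> 0" "q\<^sup>2 \<le> 4 * p * r"
  shows "p + q * t + r * t\<^sup>2 \<ge> 0"
proof (cases "r = 0")
  case True
  then show ?thesis using assms by simp
next
  case False
  have "4 * r * (p + q * t + r * t\<^sup>2) = (2 * r * t + q)\<^sup>2 + (4 * p * r - q\<^sup>2)"
    by (simp add: power2_eq_square algebra_simps)
  also have "\<dots> \<ge> 0" using assms by simp
  finally show ?thesis using False assms(2) by (simp add: zero_le_mult_iff)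
qed

lemma quadratic_leading_nonneg:
  fixes p q r :: real
  assumes "\<And>t. p + q * t + r * t\<^sup>2 \<ge> 0"
  shows "r \<ge> 0"
proof (rule ccontr)
  assume r: "\<not> r \<ge> 0"
  \<comment> \<open>Chosen so that \<open>- r * t\<close> is
    \<open>\<bar>p\<bar> + \<bar>q\<bar> - r\<close>; since \<open>t \<ge> 1\<close>, the negative
    quadratic term then outweighs the two others.\<close>
  define t where "t = 1 + (\<bar>p\<bar> + \<bar>q\<bar>) / (- r)"
  have t: "t \<ge> 1" "- r * t = \<bar>p\<bar> + \<bar>q\<bar> - r"
    using r by (simp_all add: t_def field_simps)
  have "p + q * t + r * t\<^sup>2 = p + q * t - (\<bar>p\<bar> + \<bar>q\<bar> - r) * t"
    unfolding t(2)[symmetric] by (simp add: power2_eq_square algebra_simps)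
  also have "\<dots> = (p - \<bar>p\<bar> * t) + (q - \<bar>q\<bar>) * t + r * t" by (simp add: algebra_simps)
  also have "\<dots> < 0"
  proof -
    have "p \<le> \<bar>p\<bar> * t" using t(1) by (metis abs_ge_self abs_ge_zero mult_left_mono mult.right_neutral order_trans)
    moreover have "(q - \<bar>q\<bar>) * t \<le> 0" using t(1) by (intro mult_nonpos_nonneg) auto
    moreover have "r * t < 0" using r t(1) by (intro mult_neg_pos) auto
    ultimately show ?thesis by linarith
  qed
  finally show False using assms[of t] by simp
qed

lemma quadratic_discriminant:
  fixes p q r :: real
  assumes "\<And>t. p + q * t + r * t\<^sup>2 \<ge> 0"
  shows "q\<^sup>2 \<le> 4 * p * r"
proof (cases "r = 0")
  case True
  have "q = 0"
  proof (rule ccontr)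
    assume "q \<noteq> 0"
    \<comment> \<open>The affine function takes the value -1 at this point.\<close>
    with True assms[of "- (p + 1) / q"] show False by simp
  qed
  with True show ?thesis by simp
next
  case False
  have "r \<ge> 0" using assms by (rule quadratic_leading_nonneg)
  with False have "r > 0" by simp
  have "0 \<le> 4 * r * (p + q * (- q / (2 * r)) + r * (- q / (2 * r))\<^sup>2)"
    using assms[of "- q / (2 * r)"] \<open>r > 0\<close> by (intro mult_nonneg_nonneg) simp_all
  also have "\<dots> = 4 * p * r - q\<^sup>2"
    using \<open>r > 0\<close> by (simp add: power2_eq_square field_simps)
  finally show ?thesis by simp
qed

text \<open>The discriminant of the Rayleigh difference of \<open>{i, j}\<close> in the variable \<open>k\<close> is symmetric in
  \<open>i, j, k\<close>: it is Cayley's hyperdeterminant of the eight coefficients.\<close>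

lemma hyperdeterminant_step:
  fixes c000 :: real
  assumes ij: "\<And>s. (c110 + s * c111) * (c000 + s * c001) \<le> (c100 + s * c101) * (c010 + s * c011)"
    and const: "c101 * c000 \<le> c100 * c001" and lead: "c111 * c010 \<le> c110 * c011"
  shows "(c101 + t * c111) * (c000 + t * c010) \<le> (c100 + t * c110) * (c001 + t * c011)"
proof -
  \<comment> \<open>The digits of a coefficient say whether \<open>i\<close>, \<open>j\<close>,
    \<open>k\<close> is contracted (1) or deleted (0). \<open>q\<close> is the linear coefficient of
    the difference of \<open>{i, k}\<close> in the variable \<open>j\<close>, and \<open>q'\<close>
    that of \<open>{i, j}\<close> in \<open>k\<close>.\<close>
  define q where "q = c100 * c011 + c110 * c001 - c101 * c010 - c111 * c000"
  define q' where "q' = c100 * c011 + c101 * c010 - c110 * c001 - c111 * c000"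
  have "q'\<^sup>2 \<le> 4 * (c100 * c010 - c110 * c000) * (c101 * c011 - c111 * c001)"
  proof (rule quadratic_discriminant)
    fix s
    show "0 \<le> (c100 * c010 - c110 * c000) + q' * s + (c101 * c011 - c111 * c001) * s\<^sup>2"
      using ij[of s] by (simp add: q'_def power2_eq_square algebra_simps)
  qed
  moreover have "q'\<^sup>2 - 4 * (c100 * c010 - c110 * c000) * (c101 * c011 - c111 * c001)
      = q\<^sup>2 - 4 * (c100 * c001 - c101 * c000) * (c110 * c011 - c111 * c010)"
    unfolding q_def q'_def by (simp add: power2_eq_square algebra_simps)
  ultimately have "q\<^sup>2 \<le> 4 * (c100 * c001 - c101 * c000) * (c110 * c011 - c111 * c010)"
    by linarith
  then have "0 \<le> (c100 * c001 - c101 * c000) + q * t + (c110 * c011 - c111 * c010) * t\<^sup>2"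
    using const lead by (intro quadratic_nonneg) auto
  then show ?thesis by (simp add: q_def power2_eq_square algebra_simps)
qed

lemma multiaffine_con: "multiaffine F \<Longrightarrow> multiaffine (con e F)"
  unfolding multiaffine_def
proof (intro allI)
  fix x y
  assume F: "\<forall>e y. F y = F (y(e := 0)) + y e * (F (y(e := 1)) - F (y(e := 0)))"
  show "con e F y = con e F (y(x := 0)) + y x * (con e F (y(x := 1)) - con e F (y(x := 0)))"
  proof (cases "x = e")
    case False
    have *: "F (y(e := t)) = F (y(x := 0, e := t))
        + y x * (F (y(x := 1, e := t)) - F (y(x := 0, e := t)))" for t
      using F[rule_format, of "y(e := t)" x] False by (simp add: fun_upd_twist)
    show ?thesis unfolding con_def *[of 0] *[of 1] by (simp add: algebra_simps)
  qed simp
qed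

lemma rayleigh_pair_step:
  assumes F: "multiaffine F" and ij: "rayleigh_pair i j F"
    and del: "rayleigh_pair i k (del j F)" and con: "rayleigh_pair i k (con j F)"
    and ne: "i \<noteq> j" "i \<noteq> k" "j \<noteq> k"
  shows "rayleigh_pair i k F"
  unfolding rayleigh_pair_def
proof
  fix y
  note MA = multiaffine_del multiaffine_con F
  define c000 where "c000 = del i (del j (del k F)) y"
  define c001 where "c001 = del i (del j (con k F)) y"
  define c010 where "c010 = del i (con j (del k F)) y"
  define c011 where "c011 = del i (con j (con k F)) y"
  define c100 where "c100 = con i (del j (del k F)) y"
  define c101 where "c101 = con i (del j (con k F)) y"
  define c110 where "c110 = con i (con j (del k F)) y"
  define c111 where "c111 = con i (con j (con k F)) y"
  note c = c000_def c001_def c010_def c011_def c100_def c101_def c110_def c111_def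
  have exp_k: "G (y(k := s)) = del k G y + s * con k G y" if "multiaffine G" for G s
    using multiaffine_expand[OF that, of "y(k := s)" k] by (simp only: del_con_upd fun_upd_same)
  have exp_j: "G y = del j G y + y j * con j G y" if "multiaffine G" for G
    using multiaffine_expand[OF that, of "y" j] by simp
  have commute: "del g (del h G) = del h (del g G)" "con g (con h G) = con h (con g G)"
      "con g (del h G) = del h (con g G)" "del g (con h G) = con h (del g G)"
    if "h \<noteq> g" for g h and G :: "('a \<Rightarrow> real) \<Rightarrow> real"
    using that by (simp_all add: del_con_commute[of g h] del_con_commute(3)[of h g])
  note comm = commute[OF ne(1)] commute[OF ne(2)] commute[OF ne(3)]
  \<comment> \<open>The inequality for \<open>{i, j}\<close> is used at every value \<open>s\<close>
    of \<open>y k\<close>; the conclusion is drawn at the given value of \<open>y j\<close>, which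
    plays the part of \<open>t\<close>.\<close>
  have 1: "(c110 + s * c111) * (c000 + s * c001) \<le> (c100 + s * c101) * (c010 + s * c011)" for s
  proof -
    have "con i (con j F) (y(k := s)) = c110 + s * c111"
      using exp_k[of "con i (con j F)" s] by (simp add: MA c comm)
    moreover have "del i (del j F) (y(k := s)) = c000 + s * c001"
      using exp_k[of "del i (del j F)" s] by (simp add: MA c comm)
    moreover have "con i (del j F) (y(k := s)) = c100 + s * c101"
      using exp_k[of "con i (del j F)" s] by (simp add: MA c comm)
    moreover have "con j (del i F) (y(k := s)) = c010 + s * c011"
      using exp_k[of "con j (del i F)" s] by (simp add: MA c comm)
    ultimately show ?thesis
      using ij[unfolded rayleigh_pair_def, rule_format, of "y(k := s)"] by simp
  qed
  have 2: "c101 * c000 \<le> c100 * c001"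
    using del unfolding rayleigh_pair_def c by (simp add: comm)
  have 3: "c111 * c010 \<le> c110 * c011"
    using con unfolding rayleigh_pair_def c by (simp add: comm)
  have "con i (con k F) y = c101 + y j * c111"
    using exp_j[of "con i (con k F)"] by (simp add: MA c comm)
  moreover have "del i (del k F) y = c000 + y j * c010"
    using exp_j[of "del i (del k F)"] by (simp add: MA c comm)
  moreover have "con i (del k F) y = c100 + y j * c110"
    using exp_j[of "con i (del k F)"] by (simp add: MA c comm)
  moreover have "con k (del i F) y = c001 + y j * c011"
    using exp_j[of "con k (del i F)"] by (simp add: MA c comm)
  ultimately show "con i (con k F) y * del i (del k F) y \<le> con i (del k F) y * con k (del i F) y"
    using hyperdeterminant_step[OF 1 2 3] by simp
qed

text \<open>Two exchanges reach every pair: \<open>{a, b}\<close> becomes \<open>{a, k}\<close> by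
  means of the minors at \<open>b\<close>, then \<open>{j, a}\<close> becomes \<open>{j, k}\<close>
  by means of the minors at \<open>a\<close>.\<close>

lemma rayleighI:
  assumes F: "multiaffine F" and ab: "a \<noteq> b" "rayleigh_pair a b F"
    and a: "rayleigh (del a F)" "rayleigh (con a F)"
    and b: "rayleigh (del b F)" "rayleigh (con b F)"
  shows "rayleigh F"
proof -
  have ak: "rayleigh_pair a k F" if "k \<noteq> a" for k
  proof (cases "k = b")
    case False
    then show ?thesis
      using that rayleigh_pair_step[OF F ab(2), of k] ab(1) b by (auto simp: rayleigh_def)
  qed (use ab in auto)
  have "rayleigh_pair j k F" if "j \<noteq> k" "j \<noteq> a" "k \<noteq> a" for j k
    using rayleigh_pair_step[OF F, of j a k] ak[of j] rayleigh_pair_sym[of a j F] that a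
    by (auto simp: rayleigh_def)
  then show ?thesis
    using ak unfolding rayleigh_def by (metis rayleigh_pair_sym)
qed

subsection \<open>Rayleigh polynomials are stable\<close>

text \<open>Polymorphic in the values so that the same real coefficients give a real function, for
  the Rayleigh inequalities, and a complex one, for stability.\<close>

definition multiaffine_poly :: "'a set \<Rightarrow> ('a set \<Rightarrow> real) \<Rightarrow> ('a \<Rightarrow> 'b::{real_algebra_1, comm_ring_1}) \<Rightarrow> 'b" where
  "multiaffine_poly E c y = (\<Sum>S\<in>Pow E. of_real (c S) * (\<Prod>e\<in>S. y e))"

lemma multiaffine_poly_insert:
  assumes "finite E" "x \<notin> E"
  shows "multiaffine_poly (insert x E) c y
    = multiaffine_poly E c y + y x * multiaffine_poly E (\<lambda>S. c (insert x S)) y"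
proof -
  have inj: "inj_on (insert x) (Pow E)"
    using assms(2) by (auto simp: inj_on_def)
  have "multiaffine_poly (insert x E) c y = multiaffine_poly E c y
      + (\<Sum>S\<in>insert x ` Pow E. of_real (c S) * (\<Prod>e\<in>S. y e))"
    unfolding multiaffine_poly_def Pow_insert
    using assms by (intro sum.union_disjoint) auto
  also have "(\<Sum>S\<in>insert x ` Pow E. of_real (c S) * (\<Prod>e\<in>S. y e))
      = (\<Sum>S\<in>Pow E. y x * (of_real (c (insert x S)) * (\<Prod>e\<in>S. y e)))"
    unfolding sum.reindex[OF inj] o_def
  proof (intro sum.cong refl)
    fix S assume "S \<in> Pow E"
    then have "finite S" "x \<notin> S" using assms by (auto intro: finite_subset)
    then show "of_real (c (insert x S)) * (\<Prod>e\<in>insert x S. y e)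
        = y x * (of_real (c (insert x S)) * (\<Prod>e\<in>S. y e))"
      by (simp add: mult_ac)
  qed
  finally show ?thesis by (simp add: multiaffine_poly_def sum_distrib_left)
qed

lemma multiaffine_poly_fun_upd:
  "x \<notin> E \<Longrightarrow> multiaffine_poly E c (y(x := t)) = multiaffine_poly E c y"
  unfolding multiaffine_poly_def
  by (intro sum.cong refl arg_cong2[of _ _ _ _ "(*)"] prod.cong) auto

lemma multiaffine_poly_linear:
  "multiaffine_poly E (\<lambda>S. c S + a * d S) y = multiaffine_poly E c y + of_real a * multiaffine_poly E d y"
  unfolding multiaffine_poly_def
  by (simp add: sum.distrib sum_distrib_left algebra_simps)

lemma multiaffine_poly_of_real:
  "multiaffine_poly E c (\<lambda>e. of_real (y e) :: complex) = of_real (multiaffine_poly E c y)"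
  unfolding multiaffine_poly_def by (simp add: of_real_sum of_real_prod)

lemma con_multiaffine_poly_of_real:
  "con e (multiaffine_poly E c) (\<lambda>e. of_real (y e) :: complex) = of_real (con e (multiaffine_poly E c) y)"
proof -
  have "(\<lambda>e. of_real (y e) :: complex)(e := of_real t) = (\<lambda>x. of_real ((y(e := t)) x))" for t
    by auto
  from this[of 0] this[of 1] show ?thesis
    by (simp add: con_def multiaffine_poly_of_real del: fun_upd_apply)
qed

text \<open>Makes the finiteness of the zero set of a univariate polynomial available on complex
  lines.\<close>

lemma multiaffine_poly_line:
  "\<exists>p. \<forall>s. multiaffine_poly E c (\<lambda>e. u e + s * v e) = poly p (s :: complex)"
proof (intro exI allI)
  fix s
  show "multiaffine_poly E c (\<lambda>e. u e + s * v e)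
      = poly (\<Sum>S\<in>Pow E. smult (of_real (c S)) (\<Prod>e\<in>S. [:u e, v e:])) s"
    by (simp add: multiaffine_poly_def poly_sum poly_prod)
qed

text \<open>The chain rule, with \<open>con e\<close> as partial derivative. Adding one variable at
  a time reduces it to the product rule.\<close>

lemma multiaffine_poly_has_derivative_line:
  fixes u v :: "'a \<Rightarrow> complex"
  assumes "finite E"
  shows "((\<lambda>s. multiaffine_poly E c (\<lambda>e. u e + s * v e)) has_field_derivative
    (\<Sum>e\<in>E. v e * con e (multiaffine_poly E c) (\<lambda>e. u e + s * v e))) (at s)"
  using assms
proof (induction E arbitrary: c)
  case empty
  show ?case by (simp add: multiaffine_poly_def)
next
  case (insert x E)
  let ?w = "\<lambda>s e. u e + s * v e"
  let ?c = "\<lambda>S. c (insert x S)"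
  have "((\<lambda>s. multiaffine_poly E c (?w s) + ?w s x * multiaffine_poly E ?c (?w s)) has_field_derivative
      (\<Sum>e\<in>E. v e * con e (multiaffine_poly E c) (?w s)) +
      (v x * multiaffine_poly E ?c (?w s)
        + (\<Sum>e\<in>E. v e * con e (multiaffine_poly E ?c) (?w s)) * ?w s x)) (at s)"
    by (rule insert.IH[of c] insert.IH[of ?c] derivative_eq_intros refl | simp)+
  moreover have "(\<lambda>s. multiaffine_poly (insert x E) c (?w s))
      = (\<lambda>s. multiaffine_poly E c (?w s) + ?w s x * multiaffine_poly E ?c (?w s))"
    using insert.hyps by (simp add: multiaffine_poly_insert)
  moreover have "(\<Sum>e\<in>insert x E. v e * con e (multiaffine_poly (insert x E) c) (?w s))
      = (\<Sum>e\<in>E. v e * con e (multiaffine_poly E c) (?w s)) +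
      (v x * multiaffine_poly E ?c (?w s)
        + (\<Sum>e\<in>E. v e * con e (multiaffine_poly E ?c) (?w s)) * ?w s x)"
  proof -
    have "con x (multiaffine_poly (insert x E) c) (?w s) = multiaffine_poly E ?c (?w s)"
      using insert.hyps by (simp add: con_def multiaffine_poly_insert multiaffine_poly_fun_upd)
    moreover have "con e (multiaffine_poly (insert x E) c) (?w s)
        = con e (multiaffine_poly E c) (?w s) + ?w s x * con e (multiaffine_poly E ?c) (?w s)"
      if "e \<in> E" for e
      using insert.hyps that by (auto simp: con_def multiaffine_poly_insert algebra_simps)
    ultimately show ?thesis
      using insert.hyps by (simp add: sum.distrib sum_distrib_left algebra_simps cong: sum.cong_simp)
  qed
  ultimately show ?case by (simp only:)
qed

lemma multiaffine_multiaffine_poly: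
  assumes "finite E"
  shows "multiaffine (multiaffine_poly E c)"
  unfolding multiaffine_def
proof (intro allI)
  fix e and y :: "'a \<Rightarrow> 'b"
  show "multiaffine_poly E c y = multiaffine_poly E c (y(e := 0))
      + y e * (multiaffine_poly E c (y(e := 1)) - multiaffine_poly E c (y(e := 0)))"
  proof (cases "e \<in> E")
    case True
    then obtain D where "E = insert e D" "e \<notin> D" by (meson mk_disjoint_insert)
    then show ?thesis
      using assms by (simp add: multiaffine_poly_insert multiaffine_poly_fun_upd)
  qed (simp add: multiaffine_poly_fun_upd)
qed

section \<open>Closure of the Rayleigh property under specialization and contraction\<close>

lemma rayleigh_specialize:
  assumes "rayleigh F"
  shows "rayleigh (\<lambda>y. F (y(x := t)))"
  unfolding rayleigh_def rayleigh_pair_def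
proof (intro allI impI)
  fix e f :: 'a and y :: "'a \<Rightarrow> real"
  assume ef: "e \<noteq> f"
  let ?G = "\<lambda>y. F (y(x := t))"
  show "con e (con f ?G) y * del e (del f ?G) y \<le> con e (del f ?G) y * con f (del e ?G) y"
  proof (cases "x = e \<or> x = f")
    case True
    then have "con e (con f ?G) y = 0" "con e (del f ?G) y * con f (del e ?G) y = 0"
      using ef by (auto simp: con_def del_def fun_upd_twist)
    then show ?thesis by (simp only: mult_zero_left order_refl)
  next
    case False
    then have "con e (con f ?G) y = con e (con f F) (y(x := t))"
      "del e (del f ?G) y = del e (del f F) (y(x := t))"
      "con e (del f ?G) y = con e (del f F) (y(x := t))"
      "con f (del e ?G) y = con f (del e F) (y(x := t))"
      by (auto simp: con_def del_def fun_upd_twist)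
    then show ?thesis using assms ef unfolding rayleigh_def rayleigh_pair_def by simp
  qed
qed

text \<open>The Rayleigh difference of \<open>con x F\<close> is the leading coefficient in
  \<open>y x\<close> of that of \<open>F\<close>, and a quadratic that is nonnegative everywhere has
  a nonnegative leading coefficient.\<close>

lemma rayleigh_con:
  assumes F: "multiaffine F" and ray: "rayleigh F"
  shows "rayleigh (con x F)"
  unfolding rayleigh_def rayleigh_pair_def
proof (intro allI impI)
  fix e f :: 'a and y :: "'a \<Rightarrow> real"
  assume ef: "e \<noteq> f"
  let ?G = "con x F" and ?H = "del x F"
  show "con e (con f ?G) y * del e (del f ?G) y \<le> con e (del f ?G) y * con f (del e ?G) y"
  proof (cases "x = e \<or> x = f")
    case True
    then have "con e (con f ?G) y = 0" "con e (del f ?G) y * con f (del e ?G) y = 0"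
      using ef by (auto simp: con_def del_def fun_upd_twist)
    then show ?thesis by (simp only: mult_zero_left order_refl)
  next
    case False
    have *: "K (y(x := t)) = del x K y + t * con x K y" if "multiaffine K" for K t
      using multiaffine_expand[OF that, of "y(x := t)" x] by (simp only: del_con_upd fun_upd_same)
    have comm: "con x (con g K) = con g (con x K)" "con x (del g K) = del g (con x K)"
      "del x (con g K) = con g (del x K)" "del x (del g K) = del g (del x K)"
      if "g = e \<or> g = f" for g and K :: "('a \<Rightarrow> real) \<Rightarrow> real"
      using that False del_con_commute[of x g K] del_con_commute(3)[of g x K] by auto
    have "0 \<le> con e (del f ?G) y * con f (del e ?G) y - con e (con f ?G) y * del e (del f ?G) y"
    proof (rule quadratic_leading_nonneg)
      fix t
      have "con e (con f F) (y(x := t)) * del e (del f F) (y(x := t))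
          \<le> con e (del f F) (y(x := t)) * con f (del e F) (y(x := t))"
        using ray ef unfolding rayleigh_def rayleigh_pair_def by blast
      then have "0 \<le> (con e (del f ?H) y + t * con e (del f ?G) y) * (con f (del e ?H) y + t * con f (del e ?G) y)
          - (con e (con f ?H) y + t * con e (con f ?G) y) * (del e (del f ?H) y + t * del e (del f ?G) y)"
        by (simp add: *[of "con e (con f F)"] *[of "del e (del f F)"] *[of "con e (del f F)"]
            *[of "con f (del e F)"] multiaffine_con multiaffine_del F comm del: fun_upd_apply)
      then show "0 \<le> (con e (del f ?H) y * con f (del e ?H) y - con e (con f ?H) y * del e (del f ?H) y)
          + (con e (del f ?H) y * con f (del e ?G) y + con e (del f ?G) y * con f (del e ?H) y
            - con e (con f ?H) y * del e (del f ?G) y - con e (con f ?G) y * del e (del f ?H) y) * t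
          + (con e (del f ?G) y * con f (del e ?G) y - con e (con f ?G) y * del e (del f ?G) y) * t\<^sup>2"
        by (simp add: power2_eq_square algebra_simps)
    qed
    then show ?thesis by simp
  qed
qed

text \<open>\<open>f = p / q\<close> takes no real value on the upper half-plane, so its imaginary
  part has constant sign there. On the real axis \<open>f\<close> is real and its derivative, the
  Wronskian over \<open>q\<^sup>2\<close>, is nonnegative. A negative sign above the axis therefore
  forces the Wronskian to vanish at all but finitely many real points, hence identically. Then
  \<open>f\<close> is constant along a vertical ray that starts at a real value, which is
  excluded.\<close>

lemma Im_quotient_pos:
  fixes p q :: "complex poly"
  assumes q: "\<And>s. Im s > 0 \<Longrightarrow> poly q s \<noteq> 0"
    and pq: "\<And>s \<alpha>. Im s > 0 \<Longrightarrow> poly p s + of_real \<alpha> * poly q s \<noteq> 0"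
    and real: "\<And>t. poly p (of_real t) \<in> \<real>" "\<And>t. poly q (of_real t) \<in> \<real>"
    and wronskian: "\<And>t. \<exists>d\<ge>0. poly (pderiv p * q - p * pderiv q) (of_real t) = of_real d"
    and s: "Im s > 0"
  shows "Im (poly p s / poly q s) > 0"
proof (rule ccontr)
  define f where "f z = poly p z / poly q z" for z
  define w where "w = pderiv p * q - p * pderiv q"
  have nonreal: "Im (f z) \<noteq> 0" if "Im z > 0" for z
  proof
    assume "Im (f z) = 0"
    then have "f z = of_real (Re (f z))" by (simp add: complex_eq_iff)
    then have "poly p z = of_real (Re (f z)) * poly q z"
      using q[OF that] by (simp add: f_def field_simps)
    then show False using pq[OF that, of "- Re (f z)"] by simp
  qed
  have deriv: "(f has_field_derivative poly w z / (poly q z)\<^sup>2) (at z within S)" if "poly q z \<noteq> 0" for z S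
    unfolding f_def w_def using that
    by (auto intro!: derivative_eq_intros simp: power2_eq_square poly_DERIV DERIV_subset)
  assume "\<not> Im (poly p s / poly q s) > 0"
  then have neg_s: "Im (f s) < 0" using nonreal[OF s] by (simp add: f_def)
  have neg: "Im (f z) < 0" if z: "Im z > 0" for z
  proof (rule ccontr)
    assume "\<not> Im (f z) < 0"
    then have "Im (f z) > 0" using nonreal[OF z] by simp
    have cont: "continuous_on {z. Im z > 0} (\<lambda>z. Im (f z))"
      unfolding f_def using q by (intro continuous_intros) auto
    have "connected ((\<lambda>z. Im (f z)) ` {z. Im z > 0})"
      by (rule connected_continuous_image[OF cont]) (simp add: convex_connected convex_halfspace_Im_gt)
    then have "0 \<in> (\<lambda>z. Im (f z)) ` {z. Im z > 0}"
      using connectedD_interval[of "(\<lambda>z. Im (f z)) ` {z. Im z > 0}" "Im (f s)" "Im (f z)" 0]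
        s z neg_s \<open>Im (f z) > 0\<close> by auto
    then show False using nonreal by auto
  qed
  have "q \<noteq> 0" using q[OF s] by auto
  then have fin: "finite {t. poly q (of_real t) = 0}"
    using finite_vimageI[OF poly_roots_finite[of q] inj_of_real] by (simp add: vimage_def)
  have inf: "infinite {t. poly q (of_real t) \<noteq> 0}"
    using Diff_infinite_finite[OF fin infinite_UNIV_char_0] by (simp add: set_diff_eq)
  have w0: "poly w (of_real t) = 0" if t: "poly q (of_real t) \<noteq> 0" for t
  proof (rule ccontr)
    assume nz: "poly w (of_real t) \<noteq> 0"
    obtain d where d: "d > 0" "poly w (of_real t) = of_real d"
      using wronskian[of t] nz unfolding w_def by (metis of_real_0 order_le_less)
    obtain c where c: "c \<noteq> 0" "poly q (of_real t) = of_real c"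
      using real(2)[of t] t by (metis Reals_cases of_real_0)
    \<comment> \<open>\<open>h\<close> follows the imaginary part of \<open>f\<close> vertically
      upwards from \<open>t\<close>. The derivative of \<open>f\<close> in the direction
      \<open>\<i>\<close> is \<open>\<i>\<close> times the real number \<open>d / c\<^sup>2\<close>,
      so \<open>h\<close> starts at 0 with positive slope and is positive just above the
      axis.\<close>
    define h where "h \<epsilon> = Im (f (of_real t + \<i> * of_real \<epsilon>))" for \<epsilon> :: real
    have "((\<lambda>\<epsilon>. of_real t + \<i> * of_real \<epsilon>) has_vector_derivative \<i>) (at (0 :: real))"
      by (auto intro!: derivative_eq_intros)
    moreover have "(f has_field_derivative of_real (d / c\<^sup>2)) (at (of_real t + \<i> * of_real 0))"
      using deriv[OF t] by (simp add: c d)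
    ultimately have "((f \<circ> (\<lambda>\<epsilon>. of_real t + \<i> * of_real \<epsilon>)) has_vector_derivative
        \<i> * of_real (d / c\<^sup>2)) (at 0)"
      by (rule field_vector_diff_chain_at)
    from bounded_linear.has_vector_derivative[OF bounded_linear_Im this]
    have "(h has_real_derivative d / c\<^sup>2) (at 0)"
      by (simp add: h_def[abs_def] o_def has_real_derivative_iff_has_vector_derivative)
    then obtain \<delta> where "\<delta> > 0" "\<forall>\<epsilon>>0. \<epsilon> < \<delta> \<longrightarrow> h 0 < h (0 + \<epsilon>)"
      using DERIV_pos_inc_right[of h "d / c\<^sup>2" 0] c(1) d(1) by auto
    then have "h 0 < h (\<delta> / 2)" by simp
    moreover have "h 0 = 0"
      using real[of t] unfolding h_def f_def by (simp add: complex_is_Real_iff[symmetric] Reals_divide)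
    ultimately show False using neg[of "of_real t + \<i> * of_real (\<delta> / 2)"] \<open>\<delta> > 0\<close>
      by (simp add: h_def)
  qed
  have "w = 0"
  proof (rule ccontr)
    assume "w \<noteq> 0"
    then have "finite {t. poly w (of_real t) = 0}"
      using finite_vimageI[OF poly_roots_finite[of w] inj_of_real] by (simp add: vimage_def)
    moreover have "{t. poly q (of_real t) \<noteq> 0} \<subseteq> {t. poly w (of_real t) = 0}"
      using w0 by auto
    ultimately show False using inf finite_subset by blast
  qed
  obtain t where t: "poly q (of_real t) \<noteq> 0" using inf by (metis (mono_tags, lifting) Collect_empty_eq finite.emptyI)
  \<comment> \<open>A vertical ray including its end point on the axis: it is convex and
    \<open>q\<close> has no zero on it, so a vanishing derivative within \<open>S\<close> makes
    \<open>f\<close> constant, and the end point shows that the constant is real.\<close>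
  define S where "S = {z. Re z = t \<and> 0 \<le> Im z}"
  have "convex S"
    by (auto simp: S_def convex_def simp flip: distrib_right)
  have S: "poly q z \<noteq> 0" if "z \<in> S" for z
  proof (cases "Im z = 0")
    case True
    then have "z = of_real t" using that by (simp add: S_def complex_eq_iff)
    then show ?thesis using t by simp
  qed (use that q in \<open>auto simp: S_def\<close>)
  have "(f has_field_derivative 0) (at z within S)" if "z \<in> S" for z
    using deriv[OF S[OF that], of S] by (simp add: \<open>w = 0\<close>)
  from has_field_derivative_zero_constant[OF \<open>convex S\<close> this]
  obtain k where "f z = k" if "z \<in> S" for z by blast
  then have "f (of_real t) = f (of_real t + \<i>)" by (simp add: S_def)
  moreover have "Im (f (of_real t)) = 0"
    using real[of t] unfolding f_def by (metis Reals_divide complex_is_Real_iff)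
  ultimately show False using nonreal[of "of_real t + \<i>"] by simp
qed

text \<open>Write the polynomial as \<open>A + z\<^sub>x B\<close>. Specialising \<open>z\<^sub>x\<close> to real numbers, the induction
  hypothesis says that \<open>A / B\<close> takes no real value when all variables lie in the upper half-plane. On
  the complex line through \<open>z\<close> with real base point \<open>Re z\<close> and direction \<open>Im z\<close>, its imaginary part
  therefore has constant sign, which the Rayleigh inequalities determine at the real boundary.\<close>

lemma rayleigh_imp_stable:
  assumes "finite E" "rayleigh (multiaffine_poly E c)" "\<exists>S\<subseteq>E. c S \<noteq> 0" "\<forall>e\<in>E. Im (z e) > 0"
  shows "multiaffine_poly E c z \<noteq> (0 :: complex)"
  using assms
proof (induction E arbitrary: c z)
  case empty
  then show ?case by (simp add: multiaffine_poly_def)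
next
  case (insert x E)
  define c' where "c' S = c (insert x S)" for S
  let ?F = "multiaffine_poly (insert x E) c :: ('a \<Rightarrow> real) \<Rightarrow> real"
  let ?A = "\<lambda>z :: 'a \<Rightarrow> complex. multiaffine_poly E c z"
  let ?B = "\<lambda>z :: 'a \<Rightarrow> complex. multiaffine_poly E c' z"
  have F_eq: "multiaffine_poly (insert x E) c y = multiaffine_poly E c y + y x * multiaffine_poly E c' y"
    for y :: "'a \<Rightarrow> 'b::{real_algebra_1, comm_ring_1}"
    unfolding c'_def using insert.hyps by (rule multiaffine_poly_insert)
  have MA: "multiaffine (multiaffine_poly D a :: ('a \<Rightarrow> real) \<Rightarrow> real)" if "finite D" for D a
    using that by (rule multiaffine_multiaffine_poly)
  have del_F: "del x ?F y = multiaffine_poly E c y" and con_F: "con x ?F y = multiaffine_poly E c' y" for y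
    using insert.hyps by (simp_all add: del_def con_def F_eq multiaffine_poly_fun_upd)
  have del_F': "del x ?F = multiaffine_poly E c" and con_F': "con x ?F = multiaffine_poly E c'"
    by (rule ext, rule del_F, rule ext, rule con_F)
  have pencil: "?A w + of_real \<alpha> * ?B w \<noteq> 0"
    if "\<exists>S\<subseteq>E. c S + \<alpha> * c' S \<noteq> 0" "\<forall>e\<in>E. Im (w e) > 0" for w \<alpha>
  proof -
    have "(\<lambda>y. ?F (y(x := \<alpha>))) = multiaffine_poly E (\<lambda>S. c S + \<alpha> * c' S)"
      using insert.hyps by (auto simp: F_eq multiaffine_poly_fun_upd multiaffine_poly_linear)
    with rayleigh_specialize[OF insert.prems(1), of x \<alpha>]
    have "rayleigh (multiaffine_poly E (\<lambda>S. c S + \<alpha> * c' S))" by (simp only:)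
    from insert.IH[OF this that] show ?thesis by (simp add: multiaffine_poly_linear)
  qed
  show ?case
  proof (cases "\<exists>S\<subseteq>E. c' S \<noteq> 0")
    \<comment> \<open>\<open>y x\<close> occurs in no monomial with nonzero coefficient, so the
      polynomial is the member \<open>\<alpha> = 0\<close> of the pencil.\<close>
    case False
    then have "?B z = 0" by (simp add: multiaffine_poly_def)
    moreover have "\<exists>S\<subseteq>E. c S + 0 * c' S \<noteq> 0"
    proof -
      obtain S where S: "S \<subseteq> insert x E" "c S \<noteq> 0" using insert.prems(2) by blast
      have "x \<notin> S"
      proof
        assume "x \<in> S"
        then have "c' (S - {x}) = c S" by (simp add: c'_def insert_absorb)
        moreover have "S - {x} \<subseteq> E" using S(1) by blast
        ultimately show False using False S(2) by metis
      qed
      then show ?thesis using S by auto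
    qed
    ultimately show ?thesis using pencil[of 0 z] insert.prems(3) by (simp add: F_eq)
  next
    case True
    have ray': "rayleigh (multiaffine_poly E c')"
      using rayleigh_con[OF MA insert.prems(1), of x] insert.hyps by (simp add: con_F')
    have B: "?B w \<noteq> 0" if "\<forall>e\<in>E. Im (w e) > 0" for w
      using insert.IH[OF ray' True that] .
    show ?thesis
    proof
      assume zero: "multiaffine_poly (insert x E) c z = 0"
      have zE: "\<forall>e\<in>E. Im (z e) > 0" and zx: "Im (z x) > 0" using insert.prems(3) by auto
      have Az: "?A z = - z x * ?B z" using zero by (simp add: F_eq eq_neg_iff_add_eq_0)
      \<comment> \<open>If the member at \<open>\<alpha>\<close> were identically zero, then
        \<open>z x = \<alpha>\<close> would be real.\<close>
      have nontriv: "\<exists>S\<subseteq>E. c S + \<alpha> * c' S \<noteq> 0" for \<alpha>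
      proof (rule ccontr)
        assume "\<not> ?thesis"
        then have "multiaffine_poly E (\<lambda>S. c S + \<alpha> * c' S) z = 0"
          by (simp add: multiaffine_poly_def)
        then have "(of_real \<alpha> - z x) * ?B z = 0"
          using Az by (simp add: multiaffine_poly_linear algebra_simps)
        then have "z x = of_real \<alpha>" using B[OF zE] by simp
        then show False using zx by simp
      qed
      define u v where "u e = Re (z e)" and "v e = Im (z e)" for e
      define l where "l s e = of_real (u e) + s * of_real (v e)" for s :: complex and e
      have l_upper: "\<forall>e\<in>E. Im (l s e) > 0" if "Im s > 0" for s
        using that zE by (simp add: l_def v_def)
      have l_real: "l (of_real t) = (\<lambda>e. of_real (u e + t * v e))" for t
        by (simp add: l_def fun_eq_iff)
      have l_i: "l \<i> = z" by (simp add: l_def u_def v_def fun_eq_iff complex_eq_iff)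
      obtain p q where p: "\<And>s. ?A (l s) = poly p s" and q: "\<And>s. ?B (l s) = poly q s"
        using multiaffine_poly_line[of E c "\<lambda>e. of_real (u e)" "\<lambda>e. of_real (v e)"]
          multiaffine_poly_line[of E c' "\<lambda>e. of_real (u e)" "\<lambda>e. of_real (v e)"]
        unfolding l_def[abs_def] by metis
      have deriv: "poly (pderiv r) (of_real t)
          = of_real (\<Sum>e\<in>E. v e * con e (multiaffine_poly E a) (\<lambda>e. u e + t * v e))"
        if "\<And>s. multiaffine_poly E a (l s) = poly r s" for a r t
      proof -
        have "(poly r has_field_derivative
            (\<Sum>e\<in>E. of_real (v e) * con e (multiaffine_poly E a) (l (of_real t)))) (at (of_real t))"
          using multiaffine_poly_has_derivative_line[OF insert.hyps(1), of a "\<lambda>e. of_real (u e)"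
              "\<lambda>e. of_real (v e)" "of_real t"] that
          unfolding l_def[abs_def] by simp
        moreover have "con e (multiaffine_poly E a) (l (of_real t))
            = of_real (con e (multiaffine_poly E a) (\<lambda>e. u e + t * v e))" for e
          unfolding l_real by (rule con_multiaffine_poly_of_real)
        ultimately have "(poly r has_field_derivative of_real
            (\<Sum>e\<in>E. v e * con e (multiaffine_poly E a) (\<lambda>e. u e + t * v e))) (at (of_real t))"
          by simp
        then show ?thesis by (rule DERIV_unique[OF poly_DERIV])
      qed
      \<comment> \<open>At the parameter \<open>\<i>\<close> the line passes through
        \<open>z\<close>, where the assumed zero forces \<open>A / B = - z x\<close>, a number with
        negative imaginary part.\<close>
      have "Im (poly p \<i> / poly q \<i>) > 0"
      proof (rule Im_quotient_pos)
        show "poly q s \<noteq> 0" if "Im s > 0" for s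
          using B[OF l_upper[OF that]] by (simp add: q)
        show "poly p s + of_real \<alpha> * poly q s \<noteq> 0" if "Im s > 0" for s \<alpha>
          using pencil[OF nontriv l_upper[OF that]] by (simp add: p q)
        show "poly p (of_real t) \<in> \<real>" "poly q (of_real t) \<in> \<real>" for t
          unfolding p[symmetric] q[symmetric] l_real multiaffine_poly_of_real by simp_all
        fix t
        define y where "y e = u e + t * v e" for e
        let ?a = "multiaffine_poly E c y" and ?b = "multiaffine_poly E c' y"
        \<comment> \<open>For \<open>?F = A + y x * B\<close> the Rayleigh inequality of
          \<open>{x, e}\<close> is the sign of the Wronskian of \<open>A\<close> and
          \<open>B\<close> in direction \<open>e\<close>. The positive weights \<open>v e\<close>
          carry the sign over to the direction of the line.\<close>
        have wr: "0 \<le> con e (multiaffine_poly E c) y * ?b - ?a * con e (multiaffine_poly E c') y"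
          if "e \<in> E" for e
        proof -
          have "e \<noteq> x" using that insert.hyps by blast
          then have "rayleigh_pair x e ?F" using insert.prems(1) by (simp add: rayleigh_def)
          then have "con x (con e ?F) y * del x (del e ?F) y \<le> con x (del e ?F) y * con e (del x ?F) y"
            unfolding rayleigh_pair_def by (rule spec)
          then have "con e (multiaffine_poly E c') y * del e (multiaffine_poly E c) y
              \<le> del e (multiaffine_poly E c') y * con e (multiaffine_poly E c) y"
            by (simp only: del_con_commute[OF \<open>e \<noteq> x\<close>[symmetric], of ?F] del_F' con_F')
          moreover have "?a = del e (multiaffine_poly E c) y + y e * con e (multiaffine_poly E c) y"
            "?b = del e (multiaffine_poly E c') y + y e * con e (multiaffine_poly E c') y"
            by (rule multiaffine_expand[OF MA[OF insert.hyps(1)]])+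
          ultimately show ?thesis by (simp add: algebra_simps)
        qed
        have "poly (pderiv p * q - p * pderiv q) (of_real t) = of_real (\<Sum>e\<in>E. v e *
            (con e (multiaffine_poly E c) y * ?b - ?a * con e (multiaffine_poly E c') y))"
        proof -
          have "poly p (of_real t) = of_real ?a" "poly q (of_real t) = of_real ?b"
            unfolding p[symmetric] q[symmetric] l_real multiaffine_poly_of_real y_def by simp_all
          moreover have "poly (pderiv p) (of_real t) = of_real (\<Sum>e\<in>E. v e * con e (multiaffine_poly E c) y)"
            "poly (pderiv q) (of_real t) = of_real (\<Sum>e\<in>E. v e * con e (multiaffine_poly E c') y)"
            unfolding y_def by (rule deriv p q)+
          ultimately have "poly (pderiv p * q - p * pderiv q) (of_real t)
              = of_real ((\<Sum>e\<in>E. v e * con e (multiaffine_poly E c) y) * ?b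
                - ?a * (\<Sum>e\<in>E. v e * con e (multiaffine_poly E c') y))"
            by simp
          then show ?thesis
            by (simp add: sum_distrib_left sum_distrib_right sum_subtractf right_diff_distrib mult_ac)
        qed
        moreover have "0 \<le> (\<Sum>e\<in>E. v e *
            (con e (multiaffine_poly E c) y * ?b - ?a * con e (multiaffine_poly E c') y))"
          using zE wr by (intro sum_nonneg mult_nonneg_nonneg) (auto simp: v_def less_imp_le)
        ultimately show "\<exists>d\<ge>0. poly (pderiv p * q - p * pderiv q) (of_real t) = of_real d" by blast
      qed simp
      moreover have "poly p \<i> / poly q \<i> = - z x"
        using Az B[OF zE] by (simp add: p[symmetric] q[symmetric] l_i)
      ultimately show False using zx by simp
    qed
  qed
qed

subsection \<open>Polynomials of paving matroids and their minors\<close>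

fun esym :: "nat \<Rightarrow> 'b::comm_ring_1 list \<Rightarrow> 'b" where
  "esym 0 xs = 1"
| "esym (Suc r) [] = 0"
| "esym (Suc r) (x # xs) = x * esym r xs + esym (Suc r) xs"

text \<open>The basis-generating polynomial of the rank \<open>r\<close> matroid on \<open>xs\<close> with nonbases \<open>N\<close>. Lists instead
  of sets let the simplifier compute minors when the elements are variables.\<close>

definition paving :: "'a list \<Rightarrow> nat \<Rightarrow> 'a list list \<Rightarrow> ('a \<Rightarrow> 'b::comm_ring_1) \<Rightarrow> 'b" where
  "paving xs r N y = esym r (map y xs) - (\<Sum>l\<leftarrow>N. \<Prod>x\<leftarrow>l. y x)"

lemma esym_remove1:
  assumes "x \<in> set xs"
  shows "esym (Suc r) (map y xs)
    = y x * esym r (map y (remove1 x xs)) + esym (Suc r) (map y (remove1 x xs))"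
  using assms
proof (induction xs arbitrary: r)
  case (Cons z zs)
  show ?case
  proof (cases "z = x")
    case False
    with Cons show ?thesis by (cases r) (auto simp: algebra_simps)
  qed simp
qed simp

lemma prod_list_remove1:
  "x \<in> set l \<Longrightarrow> (\<Prod>z\<leftarrow>l. y z) = (y x :: 'b::comm_ring_1) * (\<Prod>z\<leftarrow>remove1 x l. y z)"
  by (induction l) (auto simp: mult_ac)

lemma esym_eq_sum_subsets:
  "distinct xs \<Longrightarrow> esym r (map y xs) = (\<Sum>B | B \<subseteq> set xs \<and> card B = r. \<Prod>x\<in>B. y x)"
proof (induction xs arbitrary: r)
  case Nil
  show ?case
  proof (cases r)
    case 0
    then have *: "{B. B \<subseteq> set [] \<and> card B = r} = {{}}" by auto
    show ?thesis unfolding * by (simp add: 0)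
  next
    case (Suc k)
    then have *: "{B. B \<subseteq> set [] \<and> card B = r} = {}" by auto
    show ?thesis unfolding * by (simp add: Suc)
  qed
next
  case (Cons x xs)
  show ?case
  proof (cases r)
    case 0
    have "{B. B \<subseteq> set (x # xs) \<and> card B = 0} = {{}}"
      using finite_subset[OF _ finite_set[of "x # xs"]] by auto
    then show ?thesis using 0 by simp
  next
    case (Suc k)
    let ?S = "\<lambda>j. {B. B \<subseteq> set xs \<and> card B = j}"
    have fin: "finite (?S j)" for j by simp
    have split: "{B. B \<subseteq> set (x # xs) \<and> card B = r} = insert x ` ?S k \<union> ?S r"
    proof (intro equalityI subsetI)
      fix B assume "B \<in> {B. B \<subseteq> set (x # xs) \<and> card B = r}"
      then have B: "B \<subseteq> insert x (set xs)" "card B = r" by auto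
      show "B \<in> insert x ` ?S k \<union> ?S r"
      proof (cases "x \<in> B")
        case True
        then have "B - {x} \<in> ?S k" "B = insert x (B - {x})"
          using B Suc by auto
        then show ?thesis by blast
      qed (use B in auto)
    next
      fix B assume "B \<in> insert x ` ?S k \<union> ?S r"
      moreover have "card (insert x C) = r" if "C \<in> ?S k" for C
        using that Suc Cons.prems finite_subset[of C "set xs"]
        by (subst card_insert_disjoint) auto
      ultimately show "B \<in> {B. B \<subseteq> set (x # xs) \<and> card B = r}"
        by (elim UnE imageE) (auto simp del: card_insert_disjoint)
    qed
    have inj: "inj_on (insert x) (?S k)"
      using Cons.prems by (auto simp: inj_on_def insert_eq_iff subset_iff)
    have "(\<Sum>B | B \<subseteq> set (x # xs) \<and> card B = r. \<Prod>x\<in>B. y x)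
        = (\<Sum>B\<in>insert x ` ?S k. \<Prod>x\<in>B. y x) + (\<Sum>B\<in>?S r. \<Prod>x\<in>B. y x)"
      unfolding split using Cons.prems by (intro sum.union_disjoint) auto
    also have "(\<Sum>B\<in>insert x ` ?S k. \<Prod>x\<in>B. y x) = (\<Sum>B\<in>?S k. y x * (\<Prod>x\<in>B. y x))"
      unfolding sum.reindex[OF inj] o_def using Cons.prems
      by (intro sum.cong refl prod.insert) (auto intro: finite_subset)
    finally show ?thesis
      using Cons Suc by (simp add: sum_distrib_left)
  qed
qed

text \<open>Identifies a computed minor with a known matroid whose elements are listed in another
  order. The order inside each nonbasis is free, but the nonbases themselves must correspond one by
  one.\<close>

lemma paving_cong:
  fixes xs xs' :: "'a list"
  assumes "distinct xs" "distinct xs'" "set xs = set xs'"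
    and "\<forall>l\<in>set N. distinct l" "\<forall>l\<in>set N'. distinct l" "map set N = map set N'"
  shows "(paving xs r N :: ('a \<Rightarrow> 'b::comm_ring_1) \<Rightarrow> 'b) = paving xs' r N'"
proof
  fix y :: "'a \<Rightarrow> 'b"
  have *: "(\<Sum>l\<leftarrow>L. \<Prod>x\<leftarrow>l. y x) = (\<Sum>B\<leftarrow>map set L. \<Prod>x\<in>B. y x)" if "\<forall>l\<in>set L. distinct l" for L
    using that by (induction L) (simp_all add: prod.distinct_set_conv_list)
  show "paving xs r N y = paving xs' r N' y"
    unfolding paving_def *[OF assms(4)] *[OF assms(5)] assms(6)
    using assms(1-3) by (simp add: esym_eq_sum_subsets)
qed

lemma del_paving:
  assumes "distinct xs" "x \<in> set xs" "\<forall>l\<in>set N. distinct l"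
  shows "del x (paving xs r N) = paving (remove1 x xs) r (filter (\<lambda>l. x \<notin> set l) N)"
proof
  fix y
  have "esym r (map (y(x := 0)) xs) = esym r (map y (remove1 x xs))"
    using assms(1,2) by (cases r) (simp_all add: esym_remove1)
  moreover have "(\<Sum>l\<leftarrow>N. \<Prod>z\<leftarrow>l. (y(x := 0)) z) = (\<Sum>l\<leftarrow>filter (\<lambda>l. x \<notin> set l) N. \<Prod>z\<leftarrow>l. y z)"
    using assms(3) by (induction N) (auto simp: prod_list_remove1 fun_upd_same simp del: fun_upd_apply)
  ultimately show "del x (paving xs r N) y = paving (remove1 x xs) r (filter (\<lambda>l. x \<notin> set l) N) y"
    by (simp add: del_def paving_def)
qed

text \<open>The products of the nonbases that avoid \<open>x\<close> cancel in the difference. In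
  rank 0 the truncated \<open>r - 1\<close> would be wrong, as the constant \<open>esym 0\<close>
  contracts to 0.\<close>

lemma con_paving:
  assumes "distinct xs" "x \<in> set xs" "\<forall>l\<in>set N. distinct l" "0 < r"
  shows "con x (paving xs r N)
    = paving (remove1 x xs) (r - 1) (map (remove1 x) (filter (\<lambda>l. x \<in> set l) N))"
proof
  fix y
  obtain k where r: "r = Suc k" using assms(4) by (cases r) auto
  have "esym r (map (y(x := 1)) xs) - esym r (map (y(x := 0)) xs)
      = esym (r - 1) (map y (remove1 x xs))"
    using assms(1,2) by (simp add: r esym_remove1)
  moreover have "(\<Sum>l\<leftarrow>N. \<Prod>z\<leftarrow>l. (y(x := 1)) z) - (\<Sum>l\<leftarrow>N. \<Prod>z\<leftarrow>l. (y(x := 0)) z)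
      = (\<Sum>l\<leftarrow>map (remove1 x) (filter (\<lambda>l. x \<in> set l) N). \<Prod>z\<leftarrow>l. y z)"
    using assms(3)
    by (induction N) (auto simp: prod_list_remove1 algebra_simps fun_upd_same simp del: fun_upd_apply)
  ultimately show "con x (paving xs r N) y
      = paving (remove1 x xs) (r - 1) (map (remove1 x) (filter (\<lambda>l. x \<in> set l) N)) y"
    by (simp add: con_def paving_def algebra_simps)
qed

lemma multiaffine_prod_list: "distinct l \<Longrightarrow> multiaffine (\<lambda>y. \<Prod>x\<leftarrow>l. y x)"
  unfolding multiaffine_def
proof (intro allI)
  fix e and y :: "'a \<Rightarrow> 'b"
  assume l: "distinct l"
  show "(\<Prod>x\<leftarrow>l. y x) = (\<Prod>x\<leftarrow>l. (y(e := 0)) x)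
      + y e * ((\<Prod>x\<leftarrow>l. (y(e := 1)) x) - (\<Prod>x\<leftarrow>l. (y(e := 0)) x))"
    using l by (cases "e \<in> set l") (simp_all add: prod_list_remove1 del: fun_upd_apply, simp_all)
qed

lemma multiaffine_esym: "distinct xs \<Longrightarrow> multiaffine (\<lambda>y. esym r (map y xs))"
  unfolding multiaffine_def
proof (intro allI)
  fix e and y :: "'a \<Rightarrow> 'b"
  assume xs: "distinct xs"
  show "esym r (map y xs) = esym r (map (y(e := 0)) xs)
      + y e * (esym r (map (y(e := 1)) xs) - esym r (map (y(e := 0)) xs))"
    using xs by (cases "e \<in> set xs"; cases r) (simp_all add: esym_remove1)
qed

lemma multiaffine_diff:
  "multiaffine F \<Longrightarrow> multiaffine G \<Longrightarrow> multiaffine (\<lambda>y. F y - G y)"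
  unfolding multiaffine_def
proof (intro allI)
  fix e y
  assume F: "\<forall>e y. F y = F (y(e := 0)) + y e * (F (y(e := 1)) - F (y(e := 0)))"
    and G: "\<forall>e y. G y = G (y(e := 0)) + y e * (G (y(e := 1)) - G (y(e := 0)))"
  show "F y - G y = F (y(e := 0)) - G (y(e := 0))
      + y e * (F (y(e := 1)) - G (y(e := 1)) - (F (y(e := 0)) - G (y(e := 0))))"
    by (subst F[rule_format, of y e], subst G[rule_format, of y e]) (simp add: algebra_simps)
qed

lemma multiaffine_add:
  "multiaffine F \<Longrightarrow> multiaffine G \<Longrightarrow> multiaffine (\<lambda>y. F y + G y)"
  unfolding multiaffine_def
proof (intro allI)
  fix e y
  assume F: "\<forall>e y. F y = F (y(e := 0)) + y e * (F (y(e := 1)) - F (y(e := 0)))"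
    and G: "\<forall>e y. G y = G (y(e := 0)) + y e * (G (y(e := 1)) - G (y(e := 0)))"
  show "F y + G y = F (y(e := 0)) + G (y(e := 0))
      + y e * (F (y(e := 1)) + G (y(e := 1)) - (F (y(e := 0)) + G (y(e := 0))))"
    by (subst F[rule_format, of y e], subst G[rule_format, of y e]) (simp add: algebra_simps)
qed

lemma multiaffine_paving:
  fixes xs :: "'a list"
  assumes "distinct xs" "\<forall>l\<in>set N. distinct l"
  shows "multiaffine (paving xs r N :: ('a \<Rightarrow> 'b::comm_ring_1) \<Rightarrow> 'b)"
proof -
  have "multiaffine (\<lambda>y :: 'a \<Rightarrow> 'b. \<Sum>l\<leftarrow>N. \<Prod>x\<leftarrow>l. y x)"
    using assms(2)
  proof (induction N)
    case Nil
    show ?case by (simp add: multiaffine_def)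
  next
    case (Cons l N)
    then have "multiaffine (\<lambda>y :: 'a \<Rightarrow> 'b. (\<Prod>x\<leftarrow>l. y x) + (\<Sum>l\<leftarrow>N. \<Prod>x\<leftarrow>l. y x))"
      by (intro multiaffine_add multiaffine_prod_list) auto
    then show ?case by simp
  qed
  from multiaffine_diff[OF multiaffine_esym[OF assms(1)] this]
  show ?thesis unfolding paving_def[abs_def] .
qed

text \<open>The basis-generating polynomial of the loopless rank 2 matroid with parallel classes \<open>Cs\<close>.\<close>

definition parallel_classes :: "'a list list \<Rightarrow> ('a \<Rightarrow> real) \<Rightarrow> real" where
  "parallel_classes Cs y = ((\<Sum>i<length Cs. \<Sum>x\<leftarrow>Cs ! i. y x)\<^sup>2
     - (\<Sum>i<length Cs. (\<Sum>x\<leftarrow>Cs ! i. y x)\<^sup>2)) / 2"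

section \<open>Matroids of rank 2\<close>

lemma distinct_concat_nth:
  "distinct (concat Cs) \<Longrightarrow> i < length Cs \<Longrightarrow> distinct (Cs ! i)"
  by (simp add: distinct_concat_iff)

lemma distinct_concat_index_unique:
  assumes "distinct (concat Cs)" "i < length Cs" "j < length Cs" "e \<in> set (Cs ! i)" "e \<in> set (Cs ! j)"
  shows "i = j"
  using assms
proof (induction Cs arbitrary: i j)
  case (Cons C Cs)
  then show ?case
    by (cases i; cases j) (auto, (metis IntI UN_I empty_iff nth_mem)+)
qed simp

lemma sum_list_fun_upd:
  "distinct l \<Longrightarrow> (\<Sum>x\<leftarrow>l. (y(e := t)) x) = (\<Sum>x\<leftarrow>l. (y(e := 0)) x) + t * of_bool (e \<in> set l)"
  for y :: "'a \<Rightarrow> real"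
  by (induction l) (auto simp: map_fun_upd)

text \<open>Let \<open>p i\<close> be the class sums without \<open>e\<close> and \<open>f\<close>,
  \<open>P\<close> their sum and \<open>Q\<close> the sum of their squares. For \<open>e\<close>,
  \<open>f\<close> in distinct classes \<open>i\<close>, \<open>j\<close> the claim is
  \<open>P\<^sup>2 - Q \<le> 2 * (P - p i) * (P - p j)\<close>; it follows from
  \<open>(p i)\<^sup>2 + (p j)\<^sup>2 \<le> Q\<close> and
  \<open>(P - p i - p j)\<^sup>2 \<ge> 0\<close>. For parallel \<open>e\<close> and \<open>f\<close>
  the left side of the Rayleigh inequality is 0 and the right side a square.\<close>

lemma rayleigh_parallel_classes:
  assumes Cs: "distinct (concat Cs)"
  shows "rayleigh (parallel_classes Cs)"
  unfolding rayleigh_def rayleigh_pair_def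
proof (intro allI impI)
  fix e f :: 'a and y :: "'a \<Rightarrow> real"
  assume ef: "e \<noteq> f"
  define n where "n = length Cs"
  define p where "p i = (\<Sum>x\<leftarrow>Cs ! i. (y(e := 0, f := 0)) x)" for i
  \<comment> \<open>Indicators of the classes of \<open>e\<close> and \<open>f\<close>. Hence
    \<open>A\<close> and \<open>B\<close> are 1 or 0 according to whether \<open>e\<close> and
    \<open>f\<close> occur at all, and \<open>ab\<close> is 1 exactly if they are parallel.\<close>
  define a b :: "nat \<Rightarrow> real"
    where "a i = of_bool (e \<in> set (Cs ! i))" and "b i = of_bool (f \<in> set (Cs ! i))" for i
  define P A B where "P = (\<Sum>i<n. p i)" and "A = (\<Sum>i<n. a i)" and "B = (\<Sum>i<n. b i)"
  define Q where "Q = (\<Sum>i<n. (p i)\<^sup>2)"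
  define pa pb ab where "pa = (\<Sum>i<n. p i * a i)" and "pb = (\<Sum>i<n. p i * b i)"
    and "ab = (\<Sum>i<n. a i * b i)"
  have aa: "(\<Sum>i<n. (a i)\<^sup>2) = A" "(\<Sum>i<n. (b i)\<^sup>2) = B"
    unfolding A_def B_def a_def b_def by (intro sum.cong; simp)+
  have part: "(\<Sum>x\<leftarrow>Cs ! i. (y(e := t, f := u)) x) = p i + t * a i + u * b i" if "i < n" for i t u
  proof -
    have d: "distinct (Cs ! i)" using that Cs distinct_concat_nth n_def by blast
    have "(\<Sum>x\<leftarrow>Cs ! i. (y(e := t, f := u)) x) = (\<Sum>x\<leftarrow>Cs ! i. (y(e := t, f := 0)) x) + u * b i"
      unfolding b_def using sum_list_fun_upd[OF d, of "y(e := t)" f u] .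
    also have "(\<Sum>x\<leftarrow>Cs ! i. (y(e := t, f := 0)) x) = p i + t * a i"
      unfolding a_def p_def fun_upd_twist[OF ef] using sum_list_fun_upd[OF d, of "y(f := 0)" e t] .
    finally show ?thesis .
  qed
  have val: "parallel_classes Cs (y(e := t, f := u)) =
      ((P + t * A + u * B)\<^sup>2 - (Q + 2 * t * pa + 2 * u * pb + t\<^sup>2 * A + u\<^sup>2 * B + 2 * t * u * ab)) / 2"
    for t u
  proof -
    have "(\<Sum>i<n. \<Sum>x\<leftarrow>Cs ! i. (y(e := t, f := u)) x) = P + t * A + u * B"
      unfolding P_def A_def B_def
      by (simp add: part sum.distrib sum_distrib_left del: fun_upd_apply cong: sum.cong_simp)
    moreover have "(\<Sum>i<n. (\<Sum>x\<leftarrow>Cs ! i. (y(e := t, f := u)) x)\<^sup>2)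
        = Q + 2 * t * pa + 2 * u * pb + t\<^sup>2 * A + u\<^sup>2 * B + 2 * t * u * ab"
    proof -
      have "(\<Sum>i<n. (\<Sum>x\<leftarrow>Cs ! i. (y(e := t, f := u)) x)\<^sup>2) = (\<Sum>i<n. (p i + t * a i + u * b i)\<^sup>2)"
        by (simp add: part del: fun_upd_apply cong: sum.cong_simp)
      also have "\<dots> = (\<Sum>i<n. (p i)\<^sup>2 + 2 * t * (p i * a i) + 2 * u * (p i * b i) + t\<^sup>2 * (a i)\<^sup>2
          + u\<^sup>2 * (b i)\<^sup>2 + 2 * t * u * (a i * b i))"
        by (intro sum.cong refl) (simp add: power2_eq_square algebra_simps)
      also have "\<dots> = Q + 2 * t * pa + 2 * u * pb + t\<^sup>2 * A + u\<^sup>2 * B + 2 * t * u * ab"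
        unfolding Q_def pa_def pb_def ab_def aa[symmetric] by (simp add: sum.distrib sum_distrib_left)
      finally show ?thesis .
    qed
    ultimately show ?thesis unfolding parallel_classes_def n_def[symmetric] by (simp del: fun_upd_apply)
  qed
  have sel: "\<exists>i<n. (\<forall>k<n. (g \<in> set (Cs ! k)) = (k = i))" if "\<exists>i<n. g \<in> set (Cs ! i)" for g
    using that distinct_concat_index_unique[OF Cs] unfolding n_def by blast
  have pick: "(\<Sum>k<n. h k * of_bool (g \<in> set (Cs ! k))) = h i"
    if "i < n" "\<forall>k<n. (g \<in> set (Cs ! k)) = (k = i)" for h :: "nat \<Rightarrow> real" and g i
  proof -
    have "(\<Sum>k<n. h k * of_bool (g \<in> set (Cs ! k))) = (\<Sum>k<n. if k = i then h k else 0)"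
      using that(2) by (intro sum.cong) auto
    then show ?thesis using that(1) by simp
  qed
  have main: "(A * B - ab) * (P\<^sup>2 - Q) \<le> 2 * ((P * A - pa) * (P * B - pb))" and sq: "A\<^sup>2 = A" "B\<^sup>2 = B"
  proof -
    have z: "(A = 0 \<and> pa = 0 \<and> ab = 0) \<or>
        (\<exists>i<n. A = 1 \<and> pa = p i \<and> ab = b i \<and> (\<forall>k<n. (e \<in> set (Cs ! k)) = (k = i)))"
    proof (cases "\<exists>i<n. e \<in> set (Cs ! i)")
      case True
      then obtain i where i: "i < n" "\<forall>k<n. (e \<in> set (Cs ! k)) = (k = i)" using sel by blast
      have "A = 1" "pa = p i" "ab = b i"
        using pick[OF i, of "\<lambda>_. 1"] pick[OF i, of p] pick[OF i, of b]
        by (simp_all add: A_def pa_def ab_def a_def mult.commute)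
      then show ?thesis using i by blast
    qed (auto simp: A_def pa_def ab_def a_def)
    have w: "(B = 0 \<and> pb = 0 \<and> (\<forall>i<n. b i = 0)) \<or>
        (\<exists>j<n. B = 1 \<and> pb = p j \<and> (\<forall>i<n. b i = of_bool (i = j)))"
    proof (cases "\<exists>i<n. f \<in> set (Cs ! i)")
      case True
      then obtain i where i: "i < n" "\<forall>k<n. (f \<in> set (Cs ! k)) = (k = i)" using sel by blast
      have "B = 1" "pb = p i"
        using pick[OF i, of "\<lambda>_. 1"] pick[OF i, of p] by (simp_all add: B_def pb_def b_def)
      moreover have "\<forall>k<n. b k = of_bool (k = i)" using i by (simp add: b_def)
      ultimately show ?thesis using i by blast
    qed (auto simp: B_def pb_def b_def)
    show "A\<^sup>2 = A" "B\<^sup>2 = B" using z w by auto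
    show "(A * B - ab) * (P\<^sup>2 - Q) \<le> 2 * ((P * A - pa) * (P * B - pb))"
    proof (cases "A = 0 \<or> B = 0")
      case True
      then show ?thesis using z w by auto
    next
      case False
      then obtain i j where i: "i < n" "A = 1" "pa = p i" "ab = b i"
        and j: "j < n" "B = 1" "pb = p j" "\<forall>i<n. b i = of_bool (i = j)" using z w by blast
      show ?thesis
      proof (cases "i = j")
        case True
        then show ?thesis using i j by simp
      next
        case False
        have "(p i)\<^sup>2 + (p j)\<^sup>2 = (\<Sum>k\<in>{i, j}. (p k)\<^sup>2)" using False by simp
        also have "\<dots> \<le> Q" unfolding Q_def using i j by (intro sum_mono2) auto
        finally have "P\<^sup>2 - Q \<le> P\<^sup>2 - (p i)\<^sup>2 - (p j)\<^sup>2 + (P - p i - p j)\<^sup>2"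
          using zero_le_power2[of "P - p i - p j"] by linarith
        also have "\<dots> = 2 * ((P - p i) * (P - p j))" by (simp add: power2_eq_square algebra_simps)
        finally show ?thesis using False i j by simp
      qed
    qed
  qed
  let ?F = "parallel_classes Cs"
  have "con e (con f ?F) y = A * B - ab" "del e (del f ?F) y = (P\<^sup>2 - Q) / 2"
    "con e (del f ?F) y = P * A - pa" "con f (del e ?F) y = P * B - pb"
    using sq
    by (simp_all add: con_def del_def val fun_upd_twist[OF ef[symmetric]] power2_eq_square field_simps
         del: fun_upd_apply)
  then show "con e (con f ?F) y * del e (del f ?F) y \<le> con e (del f ?F) y * con f (del e ?F) y"
    using main by (simp only:)
qed

fun pairs :: "'a list \<Rightarrow> 'a list list" where
  "pairs [] = []"
| "pairs (x # xs) = map (\<lambda>z. [x, z]) xs @ pairs xs"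

lemma esym_Suc_0: "esym (Suc 0) xs = sum_list xs"
  by (induction xs) simp_all

lemma esym_2: "2 * esym 2 xs = (sum_list xs)\<^sup>2 - (\<Sum>x\<leftarrow>xs. x\<^sup>2)"
  unfolding numeral_2_eq_2 power_Suc power_0
  by (induction xs) (simp_all add: esym_Suc_0 algebra_simps)

lemma sum_pairs: "(\<Sum>l\<leftarrow>pairs xs. \<Prod>x\<leftarrow>l. y x) = esym 2 (map y xs)"
  unfolding numeral_2_eq_2
  by (induction xs) (simp_all add: esym_Suc_0 o_def sum_list_const_mult)

lemma distinct_pairs: "distinct xs \<Longrightarrow> l \<in> set (pairs xs) \<Longrightarrow> distinct l"
  by (induction xs) auto

text \<open>Newton's identity for the whole list and for each class; the squares of the single
  variables cancel.\<close>

lemma paving_rank2_eq_parallel_classes: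
  "paving (concat Cs) 2 (concat (map pairs Cs)) = parallel_classes Cs"
proof
  fix y :: "'a \<Rightarrow> real"
  have "(\<Sum>l\<leftarrow>concat (map pairs Cs). \<Prod>x\<leftarrow>l. y x) = (\<Sum>C\<leftarrow>Cs. esym 2 (map y C))"
    by (induction Cs) (simp_all add: sum_pairs)
  moreover have "2 * (\<Sum>C\<leftarrow>Cs. esym 2 (map y C))
      = (\<Sum>C\<leftarrow>Cs. (\<Sum>x\<leftarrow>C. y x)\<^sup>2) - (\<Sum>x\<leftarrow>concat Cs. (y x)\<^sup>2)"
    by (induction Cs) (simp_all add: esym_2 o_def distrib_left)
  moreover have S: "(\<Sum>x\<leftarrow>concat Cs. y x) = (\<Sum>i<length Cs. \<Sum>x\<leftarrow>Cs ! i. y x)"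
  proof -
    have "(\<Sum>x\<leftarrow>concat Cs. y x) = (\<Sum>C\<leftarrow>Cs. \<Sum>x\<leftarrow>C. y x)" by (induction Cs) simp_all
    then show ?thesis by (simp add: sum_list_sum_nth[of "map _ Cs"] lessThan_atLeast0)
  qed
  moreover have "(\<Sum>C\<leftarrow>Cs. (\<Sum>x\<leftarrow>C. y x)\<^sup>2) = (\<Sum>i<length Cs. (\<Sum>x\<leftarrow>Cs ! i. y x)\<^sup>2)"
    by (simp add: sum_list_sum_nth lessThan_atLeast0)
  moreover have "2 * esym 2 (map y (concat Cs))
      = (\<Sum>i<length Cs. \<Sum>x\<leftarrow>Cs ! i. y x)\<^sup>2 - (\<Sum>x\<leftarrow>concat Cs. (y x)\<^sup>2)"
    unfolding S[symmetric] using esym_2[of "map y (concat Cs)"] by (simp only: map_map o_def)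
  ultimately show "paving (concat Cs) 2 (concat (map pairs Cs)) y = parallel_classes Cs y"
    unfolding paving_def parallel_classes_def by argo
qed

lemma rayleigh_paving_cong:
  assumes "rayleigh (paving xs r N)" "distinct xs" "distinct xs'" "set xs = set xs'"
    and "\<forall>l\<in>set N. distinct l" "\<forall>l\<in>set N'. distinct l" "map set N = map set N'"
  shows "rayleigh (paving xs' r N')"
  using assms(1) unfolding paving_cong[OF assms(2-)] .

text \<open>Singleton classes contribute no pairs, so only the order of the larger classes has to
  match that of \<open>N\<close>.\<close>

lemma rayleigh_rank2:
  assumes "distinct (concat Cs)" "distinct xs" "set xs = set (concat Cs)"
    and "\<forall>l\<in>set N. distinct l" "map set N = map set (concat (map pairs Cs))"
  shows "rayleigh (paving xs 2 N)"
proof (rule rayleigh_paving_cong[of "concat Cs" 2 "concat (map pairs Cs)"])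
  show "rayleigh (paving (concat Cs) 2 (concat (map pairs Cs)))"
    unfolding paving_rank2_eq_parallel_classes by (rule rayleigh_parallel_classes) fact
  show "\<forall>l\<in>set (concat (map pairs Cs)). distinct l"
    using assms(1) by (auto simp: distinct_concat_iff intro: distinct_pairs)
qed (use assms in auto)

section \<open>Duality by inversion of the variables\<close>

lemma multiaffine_two_points:
  assumes F: "multiaffine F" and ef: "e \<noteq> f"
  shows "F (y(e := s, f := t')) * F (y(e := s', f := t)) - F (y(e := s, f := t)) * F (y(e := s', f := t'))
    = (s - s') * (t - t') * (con e (del f F) y * con f (del e F) y - con e (con f F) y * del e (del f F) y)"
proof -
  \<comment> \<open>The matrix of the four values is the coefficient matrix multiplied on either
    side by a Vandermonde matrix, whose determinants give the factors \<open>s - s'\<close> and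
    \<open>t - t'\<close>.\<close>
  have "F (y(e := u, f := v)) = del e (del f F) y + u * con e (del f F) y
      + v * (con f (del e F) y + u * con e (con f F) y)" for u v
  proof -
    have "F (y(e := u, f := v)) = del f F (y(e := u)) + v * con f F (y(e := u))"
      using multiaffine_expand[OF F, of "y(e := u, f := v)" f] by (simp only: del_con_upd fun_upd_same)
    also have "del f F (y(e := u)) = del e (del f F) y + u * con e (del f F) y"
      using multiaffine_expand[OF multiaffine_del[OF F], of f "y(e := u)" e]
      by (simp only: del_con_upd fun_upd_same)
    also have "con f F (y(e := u)) = del e (con f F) y + u * con e (con f F) y"
      using multiaffine_expand[OF multiaffine_con[OF F], of f "y(e := u)" e]
      by (simp only: del_con_upd fun_upd_same)
    finally show ?thesis using del_con_commute(3)[OF ef[symmetric], of F] by (simp del: fun_upd_apply)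
  qed
  then show ?thesis by (simp add: algebra_simps del: fun_upd_apply)
qed

lemma prod_fun_upd:
  assumes "finite A"
  shows "(\<Prod>x\<in>A. (y(e := t)) x) = (if e \<in> A then t else 1) * (\<Prod>x\<in>A - {e}. y x)"
proof (cases "e \<in> A")
  case True
  then have "(\<Prod>x\<in>A. (y(e := t)) x) = t * (\<Prod>x\<in>A - {e}. (y(e := t)) x)"
    using prod.remove[OF assms True, of "y(e := t)"] by simp
  also have "(\<Prod>x\<in>A - {e}. (y(e := t)) x) = (\<Prod>x\<in>A - {e}. y x)"
    by (rule prod.cong) auto
  finally show ?thesis using True by simp
next
  case False
  then have "(\<Prod>x\<in>A. (y(e := t)) x) = (\<Prod>x\<in>A. y x)"
    by (intro prod.cong) auto
  then show ?thesis using False by simp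
qed

text \<open>Inverting the variables is possible only where they do not vanish; continuity covers the other
  points. For the same reason the Rayleigh difference is computed from the values at 1 and 2 and not
  from those at 0 and 1.\<close>

lemma rayleigh_inversion:
  assumes F: "multiaffine F" and G: "multiaffine G" and E: "finite E"
    and dual: "\<And>y. \<forall>x\<in>E. y x \<noteq> 0 \<Longrightarrow> G y = (\<Prod>x\<in>E. y x) * F (\<lambda>x. inverse (y x))"
    and cont: "\<And>g :: real \<Rightarrow> 'a \<Rightarrow> real. (\<And>x. isCont (\<lambda>t. g t x) 0) \<Longrightarrow> isCont (\<lambda>t. G (g t)) 0"
    and ray: "rayleigh F"
  shows "rayleigh G"
  unfolding rayleigh_def rayleigh_pair_def
proof (intro allI impI)
  fix e f :: 'a and y :: "'a \<Rightarrow> real"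
  assume ef: "e \<noteq> f"
  define \<Delta> where "\<Delta> y = con e (del f G) y * con f (del e G) y - con e (con f G) y * del e (del f G) y" for y
  have \<Delta>: "\<Delta> y = G (y(e := 2, f := 1)) * G (y(e := 1, f := 2)) - G (y(e := 2, f := 2)) * G (y(e := 1, f := 1))" for y
    using multiaffine_two_points[OF G ef, of y 2 1 1 2] by (simp add: \<Delta>_def)
  have nonneg: "\<Delta> y \<ge> 0" if y: "\<forall>x\<in>E. y x \<noteq> 0" for y
  proof -
    define w where "w t u = (\<Prod>x\<in>E. (y(e := t, f := u)) x)" for t u :: real
    define c where "c t x = (if x \<in> E then t else 1)" for x and t :: real
    define w0 where "w0 = (\<Prod>x\<in>E - {f} - {e}. y x)"
    have w: "w t u = c t e * c u f * w0" for t u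
    proof -
      have "w t u = c u f * (\<Prod>x\<in>E - {f}. (y(e := t)) x)"
        unfolding w_def c_def by (rule prod_fun_upd[OF E])
      also have "(\<Prod>x\<in>E - {f}. (y(e := t)) x) = c t e * w0"
        using E ef prod_fun_upd[of "E - {f}" y e t] by (simp add: c_def w0_def)
      finally show ?thesis by simp
    qed
    define z where "z x = inverse (y x)" for x
    have G_eq: "G (y(e := t, f := u)) = w t u * F (z(e := inverse t, f := inverse u))"
      if "t \<noteq> 0" "u \<noteq> 0" for t u
    proof -
      have "(\<lambda>x. inverse ((y(e := t, f := u)) x)) = z(e := inverse t, f := inverse u)"
        by (auto simp: z_def)
      then show ?thesis
        using dual[of "y(e := t, f := u)"] y that unfolding w_def by auto
    qed
    \<comment> \<open>\<open>w\<close> splits into a factor in \<open>t\<close> and one in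
      \<open>u\<close>, so \<open>w 2 1 * w 1 2 = w 2 2 * w 1 1\<close> can be taken out; it is a
      positive constant times \<open>w0\<^sup>2\<close>. The inverted arguments are 1/2 and 1,
      whence the division by 4 below.\<close>
    have "\<Delta> y = w 2 1 * w 1 2 * (F (z(e := inverse 2, f := 1)) * F (z(e := 1, f := inverse 2))
        - F (z(e := inverse 2, f := inverse 2)) * F (z(e := 1, f := 1)))"
      unfolding \<Delta> by (simp add: G_eq w algebra_simps del: fun_upd_apply)
    also have "\<dots> = w 2 1 * w 1 2 * (con e (del f F) z * con f (del e F) z
        - con e (con f F) z * del e (del f F) z) / 4"
      using multiaffine_two_points[OF F ef, of z "inverse 2" 1 1 "inverse 2"] by simp
    also have "\<dots> \<ge> 0"
    proof -
      have "w 2 1 * w 1 2 = c 2 e * c 2 f * (c 1 e * c 1 f) * w0\<^sup>2"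
        by (simp add: w power2_eq_square)
      also have "\<dots> \<ge> 0" by (simp add: c_def)
      finally show ?thesis using ray ef unfolding rayleigh_def rayleigh_pair_def by simp
    qed
    finally show ?thesis .
  qed
  \<comment> \<open>Shifting all coordinates by the same small nonzero \<open>t\<close> makes those
    in \<open>E\<close> nonzero, so \<open>y\<close> is a limit of points already covered.\<close>
  have "isCont (\<lambda>t. \<Delta> (\<lambda>x. y x + t)) 0"
  proof -
    have "isCont (\<lambda>t. ((\<lambda>x. y x + t)(e := u, f := v)) x) 0" for u v x
      by (cases "x = f"; cases "x = e") simp_all
    then show ?thesis unfolding \<Delta> by (intro continuous_intros cont)
  qed
  then have "((\<lambda>t. \<Delta> (\<lambda>x. y x + t)) \<longlongrightarrow> \<Delta> y) (at 0)"
    by (simp add: isCont_def)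
  moreover have "eventually (\<lambda>t. \<forall>x\<in>E. y x + t \<noteq> 0) (at 0)"
  proof (intro eventually_ball_finite ballI E)
    fix x
    show "eventually (\<lambda>t. y x + t \<noteq> 0) (at 0)"
      by (rule eventually_mono[OF eventually_neq_at_within[of "- y x"]]) auto
  qed
  then have "eventually (\<lambda>t. 0 \<le> \<Delta> (\<lambda>x. y x + t)) (at 0)"
    by eventually_elim (rule nonneg)
  ultimately have "0 \<le> \<Delta> y"
    by (rule tendsto_lowerbound) simp
  then show "con e (con f G) y * del e (del f G) y \<le> con e (del f G) y * con f (del e G) y"
    by (simp add: \<Delta>_def)
qed

lemma isCont_esym:
  fixes g :: "real \<Rightarrow> 'a \<Rightarrow> real"
  assumes "\<And>x. isCont (\<lambda>t. g t x) a"
  shows "isCont (\<lambda>t. esym r (map (g t) xs)) a"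
proof (induction xs arbitrary: r)
  case Nil
  show ?case by (cases r) simp_all
next
  case (Cons x xs)
  show ?case by (cases r) (simp_all add: Cons assms)
qed

lemma isCont_prod_list:
  fixes g :: "real \<Rightarrow> 'a \<Rightarrow> real"
  assumes "\<And>x. isCont (\<lambda>t. g t x) a"
  shows "isCont (\<lambda>t. \<Prod>x\<leftarrow>l. g t x) a"
  by (induction l) (simp_all add: assms)

lemma isCont_paving:
  fixes g :: "real \<Rightarrow> 'a \<Rightarrow> real"
  assumes "\<And>x. isCont (\<lambda>t. g t x) a"
  shows "isCont (\<lambda>t. paving xs r N (g t)) a"
proof -
  have "isCont (\<lambda>t. \<Sum>l\<leftarrow>N. \<Prod>x\<leftarrow>l. g t x) a"
    by (induction N) (simp_all add: isCont_prod_list assms)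
  then show ?thesis
    unfolding paving_def by (intro continuous_intros isCont_esym assms)
qed

lemma esym_length_less: "length xs < r \<Longrightarrow> esym r xs = 0"
  by (induction r xs rule: esym.induct) auto

text \<open>The product over the complement of \<open>r\<close> entries is the full product divided
  by the product of these entries.\<close>

lemma esym_inverse:
  fixes xs :: "real list"
  assumes "0 \<notin> set xs" "r \<le> length xs"
  shows "esym (length xs - r) xs = prod_list xs * esym r (map inverse xs)"
  using assms
proof (induction xs arbitrary: r)
  case (Cons x xs)
  have x: "x \<noteq> 0" "0 \<notin> set xs" using Cons.prems(1) by auto
  show ?case
  proof (cases r)
    case 0
    then show ?thesis using Cons.IH[of 0] x by (simp add: esym_length_less)
  next
    case (Suc k)
    show ?thesis
    proof (cases "Suc k \<le> length xs")
      case True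
      then have "length xs - k = Suc (length xs - Suc k)" by simp
      then show ?thesis
        using Cons.IH[of k] Cons.IH[of "Suc k"] True x Suc by (simp add: algebra_simps)
    next
      case False
      then have "k = length xs" using Cons.prems(2) Suc by simp
      then show ?thesis
        using Cons.IH[of k] x Suc by (simp add: esym_length_less field_simps)
    qed
  qed
qed simp

text \<open>The bases of the dual are the complements of the bases, and so are the nonbases. Its
  polynomial is the product of all variables times the original one at the inverses.\<close>

lemma rayleigh_paving_dual:
  fixes xs :: "'a list"
  assumes ray: "rayleigh (paving xs r N)" and xs: "distinct xs" and r: "r + r' = length xs"
    and N: "\<forall>l\<in>set N. distinct l \<and> set l \<subseteq> set xs"
  shows "rayleigh (paving xs r' (map (\<lambda>l. filter (\<lambda>x. x \<notin> set l) xs) N))"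
    (is "rayleigh ?G")
proof (rule rayleigh_inversion[OF _ _ _ _ _ ray])
  show "multiaffine (paving xs r N :: ('a \<Rightarrow> real) \<Rightarrow> real)" "multiaffine ?G"
    using xs N by (auto intro!: multiaffine_paving)
  show "isCont (\<lambda>t. ?G (g t)) 0" if "\<And>x. isCont (\<lambda>t. g t x) 0" for g :: "real \<Rightarrow> 'a \<Rightarrow> real"
    by (rule isCont_paving) fact
  fix y :: "'a \<Rightarrow> real"
  assume y: "\<forall>x\<in>set xs. y x \<noteq> 0"
  let ?P = "\<Prod>x\<leftarrow>xs. y x"
  have "esym r' (map y xs) = ?P * esym r (map (\<lambda>x. inverse (y x)) xs)"
  proof -
    have "0 \<notin> set (map y xs)" using y by auto
    from esym_inverse[OF this, of r] r[symmetric] show ?thesis by (simp add: o_def)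
  qed
  moreover have "(\<Prod>x\<leftarrow>filter (\<lambda>x. x \<notin> set l) xs. y x) = ?P * (\<Prod>x\<leftarrow>l. inverse (y x))"
    if "l \<in> set N" for l
  proof -
    have l: "distinct l" "set l \<subseteq> set xs" using that N by auto
    have "(\<Prod>x\<leftarrow>filter (\<lambda>x. x \<notin> set l) xs. y x) = (\<Prod>x\<in>set xs - set l. y x)"
      using xs by (simp add: prod.distinct_set_conv_list[symmetric] set_diff_eq)
    moreover have "?P = (\<Prod>x\<in>set xs - set l. y x) * (\<Prod>x\<in>set l. y x)"
      using xs l by (simp add: prod.distinct_set_conv_list[symmetric] prod.subset_diff)
    moreover have "(\<Prod>x\<leftarrow>l. inverse (y x)) = inverse (\<Prod>x\<in>set l. y x)"
      using l by (simp add: prod.distinct_set_conv_list[symmetric] prod_inversef[symmetric] o_def)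
    moreover have "(\<Prod>x\<in>set l. y x) \<noteq> 0" using y l by auto
    ultimately show ?thesis by simp
  qed
  then have "(\<Sum>l\<leftarrow>map (\<lambda>l. filter (\<lambda>x. x \<notin> set l) xs) N. \<Prod>x\<leftarrow>l. y x)
      = ?P * (\<Sum>l\<leftarrow>N. \<Prod>x\<leftarrow>l. inverse (y x))"
    by (induction N) (simp_all add: o_def distrib_left)
  ultimately show "?G y = (\<Prod>x\<in>set xs. y x) * paving xs r N (\<lambda>x. inverse (y x))"
    using xs by (simp add: paving_def prod.distinct_set_conv_list right_diff_distrib)
qed simp

lemmas minors = con_paving del_paving

lemma esym_numeral:
  "esym (numeral k) [] = 0"
  "esym (numeral k) (x # xs) = x * esym (pred_numeral k) xs + esym (numeral k) xs"
  by (simp_all add: numeral_eq_Suc)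

text \<open>The sums of squares to which the next lemma is applied were found by semidefinite programming.
  For every matroid the pair is chosen such that its four minors have already been treated.\<close>

lemma rayleigh_pair_sum_of_squares:
  assumes "\<And>y. k * (con e (del f F) y * con f (del e F) y - con e (con f F) y * del e (del f F) y) = s y"
    and "\<And>y. 0 \<le> s y" "0 < k"
  shows "rayleigh_pair e f F"
  unfolding rayleigh_pair_def
proof
  fix y
  have "0 \<le> k * (con e (del f F) y * con f (del e F) y - con e (con f F) y * del e (del f F) y)"
    using assms(1,2) by simp
  then show "con e (con f F) y * del e (del f F) y \<le> con e (del f F) y * con f (del e F) y"
    using assms(3) by (simp add: zero_le_mult_iff)
qed

subsection \<open>The individual matroids\<close>

lemma rayleigh_U35:
  assumes d: "distinct [a, b, c, d, e]"
  shows "rayleigh (paving [a, b, c, d, e] 3 [])"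
proof -
  have "rayleigh (paving [a, b, c, d, e] 2 [])"
    by (rule rayleigh_rank2[where Cs = "[[a], [b], [c], [d], [e]]"]) (use d in auto)
  from rayleigh_paving_dual[OF this, of 3] show ?thesis
    using d by simp
qed

text \<open>Dual to the rank 2 matroid in which only \<open>d\<close> and \<open>e\<close> are
  parallel.\<close>

lemma rayleigh_line_5:
  assumes d: "distinct [a, b, c, d, e]"
  shows "rayleigh (paving [a, b, c, d, e] 3 [[a, b, c]])"
proof -
  have "rayleigh (paving [a, b, c, d, e] 2 [[d, e]])"
    by (rule rayleigh_rank2[where Cs = "[[d, e], [a], [b], [c]]"]) (use d in auto)
  from rayleigh_paving_dual[OF this, of 3] show ?thesis
    using d by simp
qed

lemma rayleigh_U36:
  assumes d: "distinct [a, b, c, d, e, f]"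
  shows "rayleigh (paving [a, b, c, d, e, f] 3 [])"
    (is "rayleigh ?F")
proof (rule rayleighI[of ?F a b])
  \<comment> \<open>The reversed list supplies every inequation in the other orientation, which the
    evaluation of \<open>remove1\<close> and of membership needs.\<close>
  note ne = d[simplified] d[THEN distinct_rev[THEN iffD2], simplified]
  show "multiaffine ?F" "a \<noteq> b" using d by (auto intro!: multiaffine_paving)
  show "rayleigh_pair a b ?F"
  proof (rule rayleigh_pair_sum_of_squares)
    fix y :: "'a \<Rightarrow> real"
    show "4 * (con a (del b ?F) y * con b (del a ?F) y
        - con a (con b ?F) y * del a (del b ?F) y)
      = (y c * y d + 2 * y c * y e + y c * y f + y d * y e + y e * y f)\<^sup>2
      + (y c * y d + y c * y f + y d * y e + 2 * y d * y f + y e * y f)\<^sup>2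
      + 2 * (y c * y d + y e * y f)\<^sup>2
      + 2 * (y c * y f - y d * y e)\<^sup>2"
      by (simp add: minors ne, simp add: paving_def esym_Suc_0 esym_numeral power2_eq_square algebra_simps)
  qed simp_all
  have "rayleigh (paving [b, c, d, e, f] 3 [])"
    by (rule rayleigh_paving_cong[OF rayleigh_U35[of b c d e f]]) (use d in auto)
  then show "rayleigh (del a ?F)" by (simp add: minors ne)
  have "rayleigh (paving [b, c, d, e, f] 2 [])"
    by (rule rayleigh_rank2[where Cs = "[[b], [c], [d], [e], [f]]"]) (use d in auto)
  then show "rayleigh (con a ?F)" by (simp add: minors ne)
  have "rayleigh (paving [a, c, d, e, f] 3 [])"
    by (rule rayleigh_paving_cong[OF rayleigh_U35[of a c d e f]]) (use d in auto)
  then show "rayleigh (del b ?F)" by (simp add: minors ne)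
  have "rayleigh (paving [a, c, d, e, f] 2 [])"
    by (rule rayleigh_rank2[where Cs = "[[a], [c], [d], [e], [f]]"]) (use d in auto)
  then show "rayleigh (con b ?F)" by (simp add: minors ne)
qed

text \<open>\<open>a\<close> is on the line and \<open>d\<close> is not: the deletion of
  \<open>a\<close> and the contraction of \<open>d\<close> are uniform, and contracting
  \<open>a\<close> makes \<open>b\<close> and \<open>c\<close> parallel.\<close>

lemma rayleigh_line_6:
  assumes d: "distinct [a, b, c, d, e, f]"
  shows "rayleigh (paving [a, b, c, d, e, f] 3 [[a, b, c]])"
    (is "rayleigh ?F")
proof (rule rayleighI[of ?F a d])
  note ne = d[simplified] d[THEN distinct_rev[THEN iffD2], simplified]
  show "multiaffine ?F" "a \<noteq> d" using d by (auto intro!: multiaffine_paving)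
  show "rayleigh_pair a d ?F"
  proof (rule rayleigh_pair_sum_of_squares)
    fix y :: "'a \<Rightarrow> real"
    show "4 * (con a (del d ?F) y * con d (del a ?F) y
        - con a (con d ?F) y * del a (del d ?F) y)
      = (y b * y e + 2 * y b * y f + y c * y f + y e * y f)\<^sup>2
      + (y b * y e + 2 * y c * y e + y c * y f + y e * y f)\<^sup>2
      + 2 * (y b * y e)\<^sup>2
      + 2 * (y c * y f)\<^sup>2
      + 2 * (y e * y f)\<^sup>2"
      by (simp add: minors ne, simp add: paving_def esym_Suc_0 esym_numeral power2_eq_square algebra_simps)
  qed simp_all
  have "rayleigh (paving [b, c, d, e, f] 3 [])"
    by (rule rayleigh_paving_cong[OF rayleigh_U35[of b c d e f]]) (use d in auto)
  then show "rayleigh (del a ?F)" by (simp add: minors ne)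
  have "rayleigh (paving [b, c, d, e, f] 2 [[b, c]])"
    by (rule rayleigh_rank2[where Cs = "[[b, c], [d], [e], [f]]"]) (use d in auto)
  then show "rayleigh (con a ?F)" by (simp add: minors ne)
  have "rayleigh (paving [a, b, c, e, f] 3 [[a, b, c]])"
    by (rule rayleigh_paving_cong[OF rayleigh_line_5[of a b c e f]]) (use d in auto)
  then show "rayleigh (del d ?F)" by (simp add: minors ne)
  have "rayleigh (paving [a, b, c, e, f] 2 [])"
    by (rule rayleigh_rank2[where Cs = "[[a], [b], [c], [e], [f]]"]) (use d in auto)
  then show "rayleigh (con d ?F)" by (simp add: minors ne)
qed

text \<open>\<open>b\<close> and \<open>d\<close> lie on different lines and off the common point
  \<open>a\<close>, so each deletion keeps one line and each contraction has one parallel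
  pair.\<close>

lemma rayleigh_two_lines_6:
  assumes d: "distinct [a, b, c, d, e, f]"
  shows "rayleigh (paving [a, b, c, d, e, f] 3 [[a, b, c], [a, d, e]])"
    (is "rayleigh ?F")
proof (rule rayleighI[of ?F b d])
  note ne = d[simplified] d[THEN distinct_rev[THEN iffD2], simplified]
  show "multiaffine ?F" "b \<noteq> d" using d by (auto intro!: multiaffine_paving)
  show "rayleigh_pair b d ?F"
  proof (rule rayleigh_pair_sum_of_squares)
    fix y :: "'a \<Rightarrow> real"
    show "4 * (con b (del d ?F) y * con d (del b ?F) y
        - con b (con d ?F) y * del b (del d ?F) y)
      = (2 * y a * y f + y c * y f + y e * y f)\<^sup>2
      + (2 * y c * y e + y c * y f + y e * y f)\<^sup>2
      + 2 * (y c * y f)\<^sup>2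
      + 2 * (y e * y f)\<^sup>2"
      by (simp add: minors ne, simp add: paving_def esym_Suc_0 esym_numeral power2_eq_square algebra_simps)
  qed simp_all
  have "rayleigh (paving [a, c, d, e, f] 3 [[a, d, e]])"
    by (rule rayleigh_paving_cong[OF rayleigh_line_5[of a d e c f]]) (use d in auto)
  then show "rayleigh (del b ?F)" by (simp add: minors ne)
  have "rayleigh (paving [a, c, d, e, f] 2 [[a, c]])"
    by (rule rayleigh_rank2[where Cs = "[[a, c], [d], [e], [f]]"]) (use d in auto)
  then show "rayleigh (con b ?F)" by (simp add: minors ne)
  have "rayleigh (paving [a, b, c, e, f] 3 [[a, b, c]])"
    by (rule rayleigh_paving_cong[OF rayleigh_line_5[of a b c e f]]) (use d in auto)
  then show "rayleigh (del d ?F)" by (simp add: minors ne)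
  have "rayleigh (paving [a, b, c, e, f] 2 [[a, e]])"
    by (rule rayleigh_rank2[where Cs = "[[a, e], [b], [c], [f]]"]) (use d in auto)
  then show "rayleigh (con d ?F)" by (simp add: minors ne)
qed

text \<open>Needed for a deletion of the non-Pappus matroid and, directly and dually, for the Vamos
  cube. As \<open>b\<close> and \<open>c\<close> lie on the same line, both deletions keep only the
  line \<open>{a, d, e}\<close>.\<close>

lemma rayleigh_two_lines_7:
  assumes d: "distinct [a, b, c, d, e, f, g]"
  shows "rayleigh (paving [a, b, c, d, e, f, g] 3 [[a, b, c], [a, d, e]])"
    (is "rayleigh ?F")
proof (rule rayleighI[of ?F b c])
  note ne = d[simplified] d[THEN distinct_rev[THEN iffD2], simplified]
  show "multiaffine ?F" "b \<noteq> c" using d by (auto intro!: multiaffine_paving)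
  show "rayleigh_pair b c ?F"
  proof (rule rayleigh_pair_sum_of_squares)
    fix y :: "'a \<Rightarrow> real"
    show "4 * (con b (del c ?F) y * con c (del b ?F) y
        - con b (con c ?F) y * del b (del c ?F) y)
      = (y a * y d + y a * y e + y a * y f + y a * y g + y d * y e + y d * y f + 2 * y d * y g + y e * y g + y f * y g)\<^sup>2
      + (y a * y d + y a * y e + y a * y f + y a * y g + y d * y e + y d * y f + 2 * y e * y f + y e * y g + y f * y g)\<^sup>2
      + 2 * (y d * y f)\<^sup>2
      + 2 * (y e * y g)\<^sup>2
      + 2 * (y f * y g)\<^sup>2
      + 2 * (y a * y d + y a * y e + y a * y f + y a * y g + y d * y e)\<^sup>2"
      by (simp add: minors ne, simp add: paving_def esym_Suc_0 esym_numeral power2_eq_square algebra_simps)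
  qed simp_all
  have "rayleigh (paving [a, c, d, e, f, g] 3 [[a, d, e]])"
    by (rule rayleigh_paving_cong[OF rayleigh_line_6[of a d e c f g]]) (use d in auto)
  then show "rayleigh (del b ?F)" by (simp add: minors ne)
  have "rayleigh (paving [a, c, d, e, f, g] 2 [[a, c]])"
    by (rule rayleigh_rank2[where Cs = "[[a, c], [d], [e], [f], [g]]"]) (use d in auto)
  then show "rayleigh (con b ?F)" by (simp add: minors ne)
  have "rayleigh (paving [a, b, d, e, f, g] 3 [[a, d, e]])"
    by (rule rayleigh_paving_cong[OF rayleigh_line_6[of a d e b f g]]) (use d in auto)
  then show "rayleigh (del c ?F)" by (simp add: minors ne)
  have "rayleigh (paving [a, b, d, e, f, g] 2 [[a, b]])"
    by (rule rayleigh_rank2[where Cs = "[[a, b], [d], [e], [f], [g]]"]) (use d in auto)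
  then show "rayleigh (con c ?F)" by (simp add: minors ne)
qed

text \<open>Three lines concurrent in \<open>a\<close>: deleting \<open>a\<close> leaves a uniform
  matroid, contracting it turns the lines into three parallel pairs. The result is used again for
  both deletions of the non-Pappus matroid and for the Vamos cube.\<close>

lemma rayleigh_F7_minus4:
  assumes d: "distinct [a, b, c, d, e, f, g]"
  shows "rayleigh (paving [a, b, c, d, e, f, g] 3 [[a, b, c], [a, d, g], [a, e, f]])"
    (is "rayleigh ?F")
proof (rule rayleighI[of ?F a b])
  note ne = d[simplified] d[THEN distinct_rev[THEN iffD2], simplified]
  show "multiaffine ?F" "a \<noteq> b" using d by (auto intro!: multiaffine_paving)
  show "rayleigh_pair a b ?F"
  proof (rule rayleigh_pair_sum_of_squares)
    fix y :: "'a \<Rightarrow> real"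
    show "4 * (con a (del b ?F) y * con b (del a ?F) y
        - con a (con b ?F) y * del a (del b ?F) y)
      = (y c * y d + y c * y e + y c * y f + y c * y g + 2 * y d * y e + y d * y f + y e * y g)\<^sup>2
      + (y c * y d + y c * y e + y c * y f + y c * y g + y d * y f + y e * y g + 2 * y f * y g)\<^sup>2
      + 2 * (y d * y f - y e * y g)\<^sup>2
      + 2 * (y c * y d + y c * y e + y c * y f + y c * y g)\<^sup>2"
      by (simp add: minors ne, simp add: paving_def esym_Suc_0 esym_numeral power2_eq_square algebra_simps)
  qed simp_all
  have "rayleigh (paving [b, c, d, e, f, g] 3 [])"
    by (rule rayleigh_paving_cong[OF rayleigh_U36[of b c d e f g]]) (use d in auto)
  then show "rayleigh (del a ?F)" by (simp add: minors ne)
  have "rayleigh (paving [b, c, d, e, f, g] 2 [[b, c], [d, g], [e, f]])"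
    by (rule rayleigh_rank2[where Cs = "[[b, c], [d, g], [e, f]]"]) (use d in auto)
  then show "rayleigh (con a ?F)" by (simp add: minors ne)
  have "rayleigh (paving [a, c, d, e, f, g] 3 [[a, d, g], [a, e, f]])"
    by (rule rayleigh_paving_cong[OF rayleigh_two_lines_6[of a d g e f c]]) (use d in auto)
  then show "rayleigh (del b ?F)" by (simp add: minors ne)
  have "rayleigh (paving [a, c, d, e, f, g] 2 [[a, c]])"
    by (rule rayleigh_rank2[where Cs = "[[a, c], [d], [e], [f], [g]]"]) (use d in auto)
  then show "rayleigh (con b ?F)" by (simp add: minors ne)
qed

text \<open>The four-point line \<open>{a, b, c, g}\<close> enters through its four triples;
  \<open>a\<close> and \<open>c\<close> are the points where the other two lines meet it. The order
  of the nonbases is such that both contractions list the pairs of the resulting three-element class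
  as \<open>pairs\<close> does.\<close>

lemma rayleigh_W3_plus:
  assumes d: "distinct [a, b, c, d, e, f, g]"
  shows "rayleigh (paving [a, b, c, d, e, f, g] 3 [[a, e, f], [c, d, e], [a, b, c], [a, b, g], [a, c, g], [b, c, g]])"
    (is "rayleigh ?F")
proof (rule rayleighI[of ?F a c])
  note ne = d[simplified] d[THEN distinct_rev[THEN iffD2], simplified]
  show "multiaffine ?F" "a \<noteq> c" using d by (auto intro!: multiaffine_paving)
  show "rayleigh_pair a c ?F"
  proof (rule rayleigh_pair_sum_of_squares)
    fix y :: "'a \<Rightarrow> real"
    \<comment> \<open>With \<open>u = y b * (y d + y e + y f)\<close>, \<open>v = y d * y f\<close>
      and \<open>w = y g * (y d + y e + y f)\<close> the difference is
      \<open>u\<^sup>2 + v\<^sup>2 + w\<^sup>2 + u * v + u * w + v * w\<close>. Completing squares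
      in this order and clearing denominators gives the factor 12.\<close>
    show "12 * (con a (del c ?F) y * con c (del a ?F) y
        - con a (con c ?F) y * del a (del c ?F) y)
      = 3 * (2 * y b * y d + 2 * y b * y e + 2 * y b * y f + y d * y f + y d * y g + y e * y g + y f * y g)\<^sup>2
      + (3 * y d * y f + y d * y g + y e * y g + y f * y g)\<^sup>2
      + 8 * (y d * y g + y e * y g + y f * y g)\<^sup>2"
      by (simp add: minors ne, simp add: paving_def esym_Suc_0 esym_numeral power2_eq_square algebra_simps)
  qed simp_all
  have "rayleigh (paving [b, c, d, e, f, g] 3 [[c, d, e], [b, c, g]])"
    by (rule rayleigh_paving_cong[OF rayleigh_two_lines_6[of c d e b g f]]) (use d in auto)
  then show "rayleigh (del a ?F)" by (simp add: minors ne)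
  have "rayleigh (paving [b, c, d, e, f, g] 2 [[e, f], [b, c], [b, g], [c, g]])"
    by (rule rayleigh_rank2[where Cs = "[[e, f], [b, c, g], [d]]"]) (use d in auto)
  then show "rayleigh (con a ?F)" by (simp add: minors ne)
  have "rayleigh (paving [a, b, d, e, f, g] 3 [[a, e, f], [a, b, g]])"
    by (rule rayleigh_paving_cong[OF rayleigh_two_lines_6[of a e f b g d]]) (use d in auto)
  then show "rayleigh (del c ?F)" by (simp add: minors ne)
  have "rayleigh (paving [a, b, d, e, f, g] 2 [[d, e], [a, b], [a, g], [b, g]])"
    by (rule rayleigh_rank2[where Cs = "[[d, e], [a, b, g], [f]]"]) (use d in auto)
  then show "rayleigh (con c ?F)" by (simp add: minors ne)
qed

text \<open>The lines form a triangle with vertices \<open>a\<close>, \<open>c\<close>,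
  \<open>e\<close>; deleting a vertex destroys two of them.\<close>

lemma rayleigh_W3_plus_e:
  assumes d: "distinct [a, b, c, d, e, f, g]"
  shows "rayleigh (paving [a, b, c, d, e, f, g] 3 [[a, b, c], [a, e, f], [c, d, e]])"
    (is "rayleigh ?F")
proof (rule rayleighI[of ?F a c])
  note ne = d[simplified] d[THEN distinct_rev[THEN iffD2], simplified]
  show "multiaffine ?F" "a \<noteq> c" using d by (auto intro!: multiaffine_paving)
  show "rayleigh_pair a c ?F"
  proof (rule rayleigh_pair_sum_of_squares)
    fix y :: "'a \<Rightarrow> real"
    show "4 * (con a (del c ?F) y * con c (del a ?F) y
        - con a (con c ?F) y * del a (del c ?F) y)
      = (y b * y d + y b * y e + y b * y f + y b * y g + 2 * y d * y f + y d * y g + y f * y g)\<^sup>2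
      + (y b * y d + y b * y e + y b * y f + y b * y g + y d * y g + 2 * y e * y g + y f * y g)\<^sup>2
      + 2 * (y d * y g)\<^sup>2
      + 2 * (y f * y g)\<^sup>2
      + 2 * (y b * y d + y b * y e + y b * y f + y b * y g)\<^sup>2"
      by (simp add: minors ne, simp add: paving_def esym_Suc_0 esym_numeral power2_eq_square algebra_simps)
  qed simp_all
  have "rayleigh (paving [b, c, d, e, f, g] 3 [[c, d, e]])"
    by (rule rayleigh_paving_cong[OF rayleigh_line_6[of c d e b f g]]) (use d in auto)
  then show "rayleigh (del a ?F)" by (simp add: minors ne)
  have "rayleigh (paving [b, c, d, e, f, g] 2 [[b, c], [e, f]])"
    by (rule rayleigh_rank2[where Cs = "[[b, c], [e, f], [d], [g]]"]) (use d in auto)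
  then show "rayleigh (con a ?F)" by (simp add: minors ne)
  have "rayleigh (paving [a, b, d, e, f, g] 3 [[a, e, f]])"
    by (rule rayleigh_paving_cong[OF rayleigh_line_6[of a e f b d g]]) (use d in auto)
  then show "rayleigh (del c ?F)" by (simp add: minors ne)
  have "rayleigh (paving [a, b, d, e, f, g] 2 [[a, b], [d, e]])"
    by (rule rayleigh_rank2[where Cs = "[[a, b], [d, e], [f], [g]]"]) (use d in auto)
  then show "rayleigh (con c ?F)" by (simp add: minors ne)
qed

text \<open>Each of the four lines contains exactly one of \<open>b\<close> and \<open>e\<close>.
  Either deletion leaves two lines that meet in the other element of the pair.\<close>

lemma rayleigh_P7_prime:
  assumes d: "distinct [a, b, c, d, e, f, g]"
  shows "rayleigh (paving [a, b, c, d, e, f, g] 3 [[a, b, c], [a, e, f], [b, f, g], [c, d, e]])"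
    (is "rayleigh ?F")
proof (rule rayleighI[of ?F b e])
  note ne = d[simplified] d[THEN distinct_rev[THEN iffD2], simplified]
  show "multiaffine ?F" "b \<noteq> e" using d by (auto intro!: multiaffine_paving)
  show "rayleigh_pair b e ?F"
  proof (rule rayleigh_pair_sum_of_squares)
    fix y :: "'a \<Rightarrow> real"
    show "4 * (con b (del e ?F) y * con e (del b ?F) y
        - con b (con e ?F) y * del b (del e ?F) y)
      = (2 * y a * y d + y a * y g - y c * y f + y d * y f + y d * y g)\<^sup>2
      + (y a * y g + y c * y f + 2 * y c * y g + y d * y f + y d * y g)\<^sup>2
      + 2 * (y d * y g)\<^sup>2
      + 2 * (y a * y g - y c * y f - y d * y f)\<^sup>2"
      by (simp add: minors ne, simp add: paving_def esym_Suc_0 esym_numeral power2_eq_square algebra_simps)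
  qed simp_all
  have "rayleigh (paving [a, c, d, e, f, g] 3 [[a, e, f], [c, d, e]])"
    by (rule rayleigh_paving_cong[OF rayleigh_two_lines_6[of e a f c d g]]) (use d in auto)
  then show "rayleigh (del b ?F)" by (simp add: minors ne)
  have "rayleigh (paving [a, c, d, e, f, g] 2 [[a, c], [f, g]])"
    by (rule rayleigh_rank2[where Cs = "[[a, c], [f, g], [d], [e]]"]) (use d in auto)
  then show "rayleigh (con b ?F)" by (simp add: minors ne)
  have "rayleigh (paving [a, b, c, d, f, g] 3 [[a, b, c], [b, f, g]])"
    by (rule rayleigh_paving_cong[OF rayleigh_two_lines_6[of b a c f g d]]) (use d in auto)
  then show "rayleigh (del e ?F)" by (simp add: minors ne)
  have "rayleigh (paving [a, b, c, d, f, g] 2 [[a, f], [c, d]])"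
    by (rule rayleigh_rank2[where Cs = "[[a, f], [c, d], [b], [g]]"]) (use d in auto)
  then show "rayleigh (con e ?F)" by (simp add: minors ne)
qed

text \<open>Three lines pass through \<open>c\<close> and the other two through \<open>h\<close>.
  Deleting one of these points leaves the lines through the other.\<close>

lemma rayleigh_non_Pappus_delete_1:
  assumes d: "distinct [a, b, c, d, e, f, g, h]"
  shows "rayleigh (paving [a, b, c, d, e, f, g, h] 3 [[c, d, e], [a, c, f], [b, c, g], [a, e, h], [b, d, h]])"
    (is "rayleigh ?F")
proof (rule rayleighI[of ?F c h])
  note ne = d[simplified] d[THEN distinct_rev[THEN iffD2], simplified]
  show "multiaffine ?F" "c \<noteq> h" using d by (auto intro!: multiaffine_paving)
  show "rayleigh_pair c h ?F"
  proof (rule rayleigh_pair_sum_of_squares)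
    fix y :: "'a \<Rightarrow> real"
    show "8 * (con c (del h ?F) y * con h (del c ?F) y
        - con c (con h ?F) y * del c (del h ?F) y)
      = 2 * (2 * y a * y b + y a * y d + y a * y g + y b * y e + y b * y f + y d * y f + y e * y g)\<^sup>2
      + 2 * (y a * y d + y a * y g - y b * y e + y d * y f + 2 * y d * y g + y e * y g + y f * y g)\<^sup>2
      + (2 * y a * y g - y b * y f + y f * y g)\<^sup>2
      + (y b * y f + 2 * y d * y f + 2 * y e * y f + y f * y g)\<^sup>2
      + (2 * y a * y d - 2 * y b * y e - y b * y f - 2 * y e * y f - 2 * y e * y g - y f * y g)\<^sup>2
      + 3 * (y b * y f + y f * y g)\<^sup>2"
      by (simp add: minors ne, simp add: paving_def esym_Suc_0 esym_numeral power2_eq_square algebra_simps)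
  qed simp_all
  have "rayleigh (paving [a, b, d, e, f, g, h] 3 [[a, e, h], [b, d, h]])"
    by (rule rayleigh_paving_cong[OF rayleigh_two_lines_7[of h a e b d f g]]) (use d in auto)
  then show "rayleigh (del c ?F)" by (simp add: minors ne)
  have "rayleigh (paving [a, b, d, e, f, g, h] 2 [[d, e], [a, f], [b, g]])"
    by (rule rayleigh_rank2[where Cs = "[[d, e], [a, f], [b, g], [h]]"]) (use d in auto)
  then show "rayleigh (con c ?F)" by (simp add: minors ne)
  have "rayleigh (paving [a, b, c, d, e, f, g] 3 [[c, d, e], [a, c, f], [b, c, g]])"
    by (rule rayleigh_paving_cong[OF rayleigh_F7_minus4[of c d e a b g f]]) (use d in auto)
  then show "rayleigh (del h ?F)" by (simp add: minors ne)
  have "rayleigh (paving [a, b, c, d, e, f, g] 2 [[a, e], [b, d]])"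
    by (rule rayleigh_rank2[where Cs = "[[a, e], [b, d], [c], [f], [g]]"]) (use d in auto)
  then show "rayleigh (con h ?F)" by (simp add: minors ne)
qed

text \<open>Three of the six lines pass through \<open>a\<close> and the other three through
  \<open>d\<close>, so both deletions are three concurrent lines.\<close>

lemma rayleigh_non_Pappus_delete_9:
  assumes d: "distinct [a, b, c, d, e, f, g, h]"
  shows "rayleigh (paving [a, b, c, d, e, f, g, h] 3 [[a, b, c], [d, e, f], [a, e, g], [b, d, g], [a, f, h], [c, d, h]])"
    (is "rayleigh ?F")
proof (rule rayleighI[of ?F a d])
  note ne = d[simplified] d[THEN distinct_rev[THEN iffD2], simplified]
  show "multiaffine ?F" "a \<noteq> d" using d by (auto intro!: multiaffine_paving)
  show "rayleigh_pair a d ?F"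
  proof (rule rayleigh_pair_sum_of_squares)
    fix y :: "'a \<Rightarrow> real"
    show "4 * (con a (del d ?F) y * con d (del a ?F) y
        - con a (con d ?F) y * del a (del d ?F) y)
      = (2 * y b * y e + y b * y f + y b * y h + y c * y e - y c * y g + y e * y h - y f * y g)\<^sup>2
      + (y b * y f - y b * y h + y c * y e + 2 * y c * y f + y c * y g - y e * y h + y f * y g)\<^sup>2
      + 2 * (y b * y f + y b * y h + y f * y g + y g * y h)\<^sup>2
      + 2 * (y c * y e + y c * y g + y e * y h + y g * y h)\<^sup>2"
      by (simp add: minors ne, simp add: paving_def esym_Suc_0 esym_numeral power2_eq_square algebra_simps)
  qed simp_all
  have "rayleigh (paving [b, c, d, e, f, g, h] 3 [[d, e, f], [b, d, g], [c, d, h]])"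
    by (rule rayleigh_paving_cong[OF rayleigh_F7_minus4[of d e f b c h g]]) (use d in auto)
  then show "rayleigh (del a ?F)" by (simp add: minors ne)
  have "rayleigh (paving [b, c, d, e, f, g, h] 2 [[b, c], [e, g], [f, h]])"
    by (rule rayleigh_rank2[where Cs = "[[b, c], [e, g], [f, h], [d]]"]) (use d in auto)
  then show "rayleigh (con a ?F)" by (simp add: minors ne)
  have "rayleigh (paving [a, b, c, e, f, g, h] 3 [[a, b, c], [a, e, g], [a, f, h]])"
    by (rule rayleigh_paving_cong[OF rayleigh_F7_minus4[of a b c e f h g]]) (use d in auto)
  then show "rayleigh (del d ?F)" by (simp add: minors ne)
  have "rayleigh (paving [a, b, c, e, f, g, h] 2 [[e, f], [b, g], [c, h]])"
    by (rule rayleigh_rank2[where Cs = "[[e, f], [b, g], [c, h], [a]]"]) (use d in auto)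
  then show "rayleigh (con d ?F)" by (simp add: minors ne)
qed

text \<open>The contractions of \<open>a\<close> and \<open>e\<close> are three lines through
  \<open>c\<close> and two lines through \<open>f\<close>. The deletions have rank 4 on seven
  elements; the complements of their nonbases are two lines through \<open>c\<close> and three lines
  through \<open>f\<close>, so their duals are of the same two types.\<close>

lemma rayleigh_Vamos_cube:
  assumes d: "distinct [a, b, c, d, e, f, g, h]"
  shows "rayleigh (paving [a, b, c, d, e, f, g, h] 4 [[a, b, c, d], [a, c, e, f], [b, d, e, f], [a, c, g, h], [b, d, g, h]])"
    (is "rayleigh ?F")
proof (rule rayleighI[of ?F a e])
  note ne = d[simplified] d[THEN distinct_rev[THEN iffD2], simplified]
  show "multiaffine ?F" "a \<noteq> e" using d by (auto intro!: multiaffine_paving)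
  show "rayleigh_pair a e ?F"
  proof (rule rayleigh_pair_sum_of_squares)
    fix y :: "'a \<Rightarrow> real"
    show "4 * (con a (del e ?F) y * con e (del a ?F) y
        - con a (con e ?F) y * del a (del e ?F) y)
      = (2 * y b * y c * y f + y b * y c * y g + y b * y c * y h + y b * y f * y g + y b * y f * y h + 2 * y c * y d * y f + y c * y d * y g + y c * y d * y h + 2 * y c * y f * y g + 2 * y c * y f * y h + y d * y f * y g + y d * y f * y h + y f * y g * y h)\<^sup>2
      + (y b * y c * y g + y b * y c * y h + 2 * y b * y d * y g + 2 * y b * y d * y h + y b * y f * y g + y b * y f * y h + 2 * y b * y g * y h + y c * y d * y g + y c * y d * y h + y d * y f * y g + y d * y f * y h + 2 * y d * y g * y h + y f * y g * y h)\<^sup>2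
      + 2 * (y b * y f * y h)\<^sup>2
      + 2 * (y d * y f * y g)\<^sup>2
      + 2 * (y f * y g * y h)\<^sup>2
      + 2 * (y b * y c * y g - y c * y d * y h)\<^sup>2
      + 2 * (y b * y c * y h - y c * y d * y g)\<^sup>2
      + 2 * (y b * y f * y g - y d * y f * y h)\<^sup>2"
      by (simp add: minors ne, simp add: paving_def esym_Suc_0 esym_numeral power2_eq_square algebra_simps)
  qed simp_all
  have "rayleigh (paving [b, c, d, e, f, g, h] 4 [[b, d, e, f], [b, d, g, h]])"
    by (rule rayleigh_paving_cong[OF rayleigh_paving_dual[OF rayleigh_two_lines_7[of c g h e f b d]]])
        (use d in auto)
  then show "rayleigh (del a ?F)" by (simp add: minors ne)
  have "rayleigh (paving [b, c, d, e, f, g, h] 3 [[b, c, d], [c, e, f], [c, g, h]])"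
    by (rule rayleigh_paving_cong[OF rayleigh_F7_minus4[of c b d e g h f]]) (use d in auto)
  then show "rayleigh (con a ?F)" by (simp add: minors ne)
  have "rayleigh (paving [a, b, c, d, f, g, h] 4 [[a, b, c, d], [a, c, g, h], [b, d, g, h]])"
    by (rule rayleigh_paving_cong[OF rayleigh_paving_dual[OF rayleigh_F7_minus4[of f g h b a c d]]])
        (use d in auto)
  then show "rayleigh (del e ?F)" by (simp add: minors ne)
  have "rayleigh (paving [a, b, c, d, f, g, h] 3 [[a, c, f], [b, d, f]])"
    by (rule rayleigh_paving_cong[OF rayleigh_two_lines_7[of f a c b d g h]]) (use d in auto)
  then show "rayleigh (con e ?F)" by (simp add: minors ne)
qed

subsection \<open>Basis-generating polynomials\<close>

lemma partial_deriv_multiaffine: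
  assumes "multiaffine F"
  shows "partial_deriv e F = con e F"
proof
  fix y
  have "(\<lambda>t. F (y(e := t))) = (\<lambda>t. del e F y + t * con e F y)"
    using multiaffine_expand[OF assms, of "y(e := _)" e] by (simp add: fun_eq_iff del: fun_upd_apply) simp
  moreover have "((\<lambda>t. del e F y + t * con e F y) has_field_derivative con e F y) (at (y e))"
    by (auto intro!: derivative_eq_intros)
  ultimately show "partial_deriv e F y = con e F y"
    unfolding partial_deriv_def by (simp add: DERIV_imp_deriv)
qed

text \<open>After expansion in \<open>y e\<close> and \<open>y f\<close> all terms that contain
  these variables cancel.\<close>

lemma multiaffine_Rayleigh_difference:
  assumes "multiaffine F" "e \<noteq> f"
  shows "con e F y * con f F y - con e (con f F) y * F y
    = con e (del f F) y * con f (del e F) y - con e (con f F) y * del e (del f F) y"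
proof -
  have "con e F y = con e (del f F) y + y f * con e (con f F) y"
    using multiaffine_expand[OF multiaffine_con[OF assms(1)], of e y f]
      del_con_commute[OF assms(2)[symmetric], of F] del_con_commute(3)[OF assms(2), of F] by simp
  moreover have "con f F y = con f (del e F) y + y e * con e (con f F) y"
    using multiaffine_expand[OF multiaffine_con[OF assms(1)], of f y e]
      del_con_commute(3)[OF assms(2)[symmetric], of F] by simp
  moreover have "F y = del e (del f F) y + y e * con e (del f F) y
      + y f * (con f (del e F) y + y e * con e (con f F) y)"
    using multiaffine_expand[OF assms(1), of y f]
      multiaffine_expand[OF multiaffine_del[OF assms(1)], of f y e]
      multiaffine_expand[OF multiaffine_con[OF assms(1)], of f y e]
      del_con_commute(3)[OF assms(2)[symmetric], of F] by simp
  ultimately show ?thesis by (simp only:) (simp add: algebra_simps)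
qed

lemma basis_poly_eq_multiaffine_poly:
  fixes y :: "'a \<Rightarrow> 'b::{real_algebra_1, comm_ring_1}"
  assumes "matroid M"
  shows "basis_poly M y = multiaffine_poly (ground M) (\<lambda>S. of_bool (S \<in> bases M)) y"
proof -
  have "bases M \<subseteq> Pow (ground M)" "finite (Pow (ground M))"
    using assms by (auto simp: matroid_def)
  then show ?thesis
    unfolding basis_poly_def multiaffine_poly_def
    by (intro sum.mono_neutral_cong_left) auto
qed

text \<open>Multiplication by \<open>\<i>\<close> carries the right half-plane to the upper one, and
  by homogeneity it only changes the polynomial by the factor \<open>\<i> ^ r\<close>.\<close>

lemma half_plane_and_strong_Rayleigh:
  fixes M :: "'a basis_system"
  assumes M: "matroid M" and card: "\<And>B. B \<in> bases M \<Longrightarrow> card B = r"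
    and ray: "rayleigh (basis_poly M)"
  shows "half_plane_property M \<and> strong_Rayleigh_property M"
proof
  let ?c = "\<lambda>S. of_bool (S \<in> bases M) :: real"
  have fin: "finite (ground M)" using M by (simp add: matroid_def)
  have F: "(basis_poly M :: ('a \<Rightarrow> real) \<Rightarrow> real) = multiaffine_poly (ground M) ?c"
    using basis_poly_eq_multiaffine_poly[OF M] by auto
  show "half_plane_property M"
    unfolding half_plane_property_def
  proof (intro allI impI)
    fix y :: "'a \<Rightarrow> complex"
    assume y: "\<forall>e\<in>ground M. 0 < Re (y e)"
    have "basis_poly M (\<lambda>e. \<i> * y e) = (\<Sum>B\<in>bases M. \<i> ^ r * (\<Prod>e\<in>B. y e))"
      unfolding basis_poly_def by (intro sum.cong refl) (simp add: prod.distrib card)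
    also have "\<dots> = \<i> ^ r * basis_poly M y"
      by (simp add: basis_poly_def sum_distrib_left)
    finally have "\<i> ^ r * basis_poly M y = multiaffine_poly (ground M) ?c (\<lambda>e. \<i> * y e)"
      using basis_poly_eq_multiaffine_poly[OF M, of "\<lambda>e. \<i> * y e"] by simp
    moreover have "\<dots> \<noteq> 0"
    proof (rule rayleigh_imp_stable[OF fin])
      show "rayleigh (multiaffine_poly (ground M) ?c)" using ray by (simp only: F)
      show "\<exists>S\<subseteq>ground M. ?c S \<noteq> 0" using M by (auto simp: matroid_def)
      show "\<forall>e\<in>ground M. 0 < Im (\<i> * y e)" using y by simp
    qed
    ultimately show "basis_poly M y \<noteq> 0" by auto
  qed
  have MA: "multiaffine (basis_poly M :: ('a \<Rightarrow> real) \<Rightarrow> real)"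
    unfolding F by (rule multiaffine_multiaffine_poly[OF fin])
  show "strong_Rayleigh_property M"
    unfolding strong_Rayleigh_property_def
  proof (intro ballI impI allI)
    fix e f :: 'a and y :: "'a \<Rightarrow> real"
    assume ef: "e \<noteq> f"
    show "0 \<le> partial_deriv e (basis_poly M) y * partial_deriv f (basis_poly M) y
        - partial_deriv e (partial_deriv f (basis_poly M)) y * basis_poly M y"
      using ray ef
      by (simp add: partial_deriv_multiaffine MA multiaffine_con multiaffine_Rayleigh_difference
          rayleigh_def rayleigh_pair_def)
  qed
qed

text \<open>\<open>distinct (map set N)\<close> ensures that each nonbasis is subtracted only
  once.\<close>

lemma basis_poly_eq_paving:
  fixes y :: "'a \<Rightarrow> 'b::comm_ring_1"
  assumes bases: "bases M = {B. B \<subseteq> set xs \<and> card B = r} - set (map set N)"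
    and xs: "distinct xs" and N: "distinct (map set N)"
    and l: "\<forall>l\<in>set N. distinct l \<and> length l = r \<and> set l \<subseteq> set xs"
  shows "basis_poly M y = paving xs r N y"
proof -
  have "basis_poly M y
      = (\<Sum>B | B \<subseteq> set xs \<and> card B = r. \<Prod>e\<in>B. y e) - (\<Sum>B\<in>set (map set N). \<Prod>e\<in>B. y e)"
    unfolding basis_poly_def bases
    using l by (intro sum_diff) (auto simp: distinct_card)
  also have "(\<Sum>B\<in>set (map set N). \<Prod>e\<in>B. y e) = (\<Sum>B\<leftarrow>map set N. \<Prod>e\<in>B. y e)"
    using N by (rule sum.distinct_set_conv_list)
  also have "\<dots> = (\<Sum>l\<leftarrow>N. \<Prod>e\<leftarrow>l. y e)"
    unfolding map_map o_def
    using l by (intro arg_cong[of _ _ sum_list] map_cong refl) (simp add: prod.distinct_set_conv_list)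
  finally show ?thesis
    using xs by (simp add: paving_def esym_eq_sum_subsets)
qed

lemma half_plane_and_strong_Rayleigh_paving:
  assumes "matroid M" and bases: "bases M = {B. B \<subseteq> set xs \<and> card B = r} - set (map set N)"
    and "rayleigh (paving xs r N)" and "distinct xs" "distinct (map set N)"
    and "\<forall>l\<in>set N. distinct l \<and> length l = r \<and> set l \<subseteq> set xs"
  shows "half_plane_property M \<and> strong_Rayleigh_property M"
proof (rule half_plane_and_strong_Rayleigh[OF assms(1)])
  have "(basis_poly M :: _ \<Rightarrow> real) = paving xs r N"
    using basis_poly_eq_paving[OF bases assms(4-6)] by auto
  with assms(3) show "rayleigh (basis_poly M)" by simp
qed (simp add: bases)

lemma bases_from_nonbases:
  "{1..n} = set xs \<Longrightarrow> N = set (map set L) \<Longrightarrow>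
    bases (from_nonbases n r N) = {B. B \<subseteq> set xs \<and> card B = r} - set (map set L)"
  by (auto simp: from_nonbases_def)

text \<open>Lets the nonbases that avoid a deleted element be selected one at a time from an
  explicit set.\<close>

lemma Collect_mem_insert:
  "{x \<in> insert a A. P x} = (if P a then insert a {x \<in> A. P x} else {x \<in> A. P x})"
  by auto

lemma bases_delete_from_nonbases:
  assumes "{1..n} - {e} = set xs" "{B \<in> N. e \<notin> B} = set (map set L)"
  shows "bases (delete (from_nonbases n r N) e) = {B. B \<subseteq> set xs \<and> card B = r} - set (map set L)"
  unfolding assms[symmetric] by (auto simp: from_nonbases_def delete_def)

theorem mainTheorem2:
  fixes M :: "nat basis_system"
  assumes "M \<in> {F7_minus4, W3_plus, W3_plus_e, P7_prime,
                delete non_Pappus 1, delete non_Pappus 9, Vamos_cube}"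
  shows "half_plane_property M \<and> strong_Rayleigh_property M"
proof -
  have seven: "{1..7} = set [1, 2, 3, 4, 5, 6, 7 :: nat]"
    and eight: "{1..8} = set [1, 2, 3, 4, 5, 6, 7, 8 :: nat]"
    by auto
  consider "M = F7_minus4" | "M = W3_plus" | "M = W3_plus_e" | "M = P7_prime"
    | "M = delete non_Pappus 1" | "M = delete non_Pappus 9" | "M = Vamos_cube"
    using assms by blast
  then show ?thesis
  proof cases
    case 1
    have "bases F7_minus4 = {B. B \<subseteq> set [1, 2, 3, 4, 5, 6, 7] \<and> card B = 3}
        - set (map set [[1, 2, 3], [1, 4, 7], [1, 5, 6]])"
      unfolding F7_minus4_def by (rule bases_from_nonbases[OF seven]) simp
    from half_plane_and_strong_Rayleigh_paving[OF matroid_F7_minus4 this rayleigh_F7_minus4]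
    show ?thesis unfolding 1 by (simp add: set_eq_subset)
  next
    case 2
    \<comment> \<open>\<open>paving\<close> requires the triples of the four-point line as an
      explicit list; they are found by running through all sixteen subsets.\<close>
    have "S \<in> {S. S \<subseteq> {1, 2, 3, 7} \<and> card S = 3}
        \<longleftrightarrow> S \<in> {{1, 2, 3}, {1, 2, 7}, {1, 3, 7}, {2, 3, 7}}" for S :: "nat set"
    proof
      assume "S \<in> {S. S \<subseteq> {1, 2, 3, 7} \<and> card S = 3}"
      then have "S \<in> Pow {1, 2, 3, 7}" "card S = 3" by auto
      then show "S \<in> {{1, 2, 3}, {1, 2, 7}, {1, 3, 7}, {2, 3, 7}}"
        unfolding Pow_insert Pow_empty by (elim UnE imageE insertE emptyE) auto
    qed auto
    then have line: "{S. S \<subseteq> {1, 2, 3, 7} \<and> card S = 3}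
        = {{1, 2, 3}, {1, 2, 7}, {1, 3, 7}, {2, 3, 7 :: nat}}"
      by blast
    have "bases W3_plus = {B. B \<subseteq> set [1, 2, 3, 4, 5, 6, 7] \<and> card B = 3}
        - set (map set [[1, 5, 6], [3, 4, 5], [1, 2, 3], [1, 2, 7], [1, 3, 7], [2, 3, 7]])"
      unfolding W3_plus_def by (rule bases_from_nonbases[OF seven]) (simp only: line, simp)
    from half_plane_and_strong_Rayleigh_paving[OF matroid_W3_plus this rayleigh_W3_plus]
    show ?thesis unfolding 2 by (simp add: set_eq_subset)
  next
    case 3
    have "bases W3_plus_e = {B. B \<subseteq> set [1, 2, 3, 4, 5, 6, 7] \<and> card B = 3}
        - set (map set [[1, 2, 3], [1, 5, 6], [3, 4, 5]])"
      unfolding W3_plus_e_def by (rule bases_from_nonbases[OF seven]) simp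
    from half_plane_and_strong_Rayleigh_paving[OF matroid_W3_plus_e this rayleigh_W3_plus_e]
    show ?thesis unfolding 3 by (simp add: set_eq_subset)
  next
    case 4
    have "bases P7_prime = {B. B \<subseteq> set [1, 2, 3, 4, 5, 6, 7] \<and> card B = 3}
        - set (map set [[1, 2, 3], [1, 5, 6], [2, 6, 7], [3, 4, 5]])"
      unfolding P7_prime_def by (rule bases_from_nonbases[OF seven]) simp
    from half_plane_and_strong_Rayleigh_paving[OF matroid_P7_prime this rayleigh_P7_prime]
    show ?thesis unfolding 4 by (simp add: set_eq_subset)
  next
    case 5
    have "bases (delete non_Pappus 1) = {B. B \<subseteq> set [2, 3, 4, 5, 6, 7, 8, 9] \<and> card B = 3}
        - set (map set [[4, 5, 6], [2, 4, 7], [3, 4, 8], [2, 6, 9], [3, 5, 9]])"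
      unfolding non_Pappus_def
    proof (rule bases_delete_from_nonbases)
      show "{1..9} - {1} = set [2, 3, 4, 5, 6, 7, 8, 9 :: nat]" by auto
    qed (unfold Collect_mem_insert, simp)
    from half_plane_and_strong_Rayleigh_paving[OF matroid_non_Pappus_delete(1) this
        rayleigh_non_Pappus_delete_1]
    show ?thesis unfolding 5 by (simp add: set_eq_subset)
  next
    case 6
    have "bases (delete non_Pappus 9) = {B. B \<subseteq> set [1, 2, 3, 4, 5, 6, 7, 8] \<and> card B = 3}
        - set (map set [[1, 2, 3], [4, 5, 6], [1, 5, 7], [2, 4, 7], [1, 6, 8], [3, 4, 8]])"
      unfolding non_Pappus_def
    proof (rule bases_delete_from_nonbases)
      show "{1..9} - {9} = set [1, 2, 3, 4, 5, 6, 7, 8 :: nat]" by auto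
    qed (unfold Collect_mem_insert, simp)
    from half_plane_and_strong_Rayleigh_paving[OF matroid_non_Pappus_delete(2) this
        rayleigh_non_Pappus_delete_9]
    show ?thesis unfolding 6 by (simp add: set_eq_subset)
  next
    case 7
    have "bases Vamos_cube = {B. B \<subseteq> set [1, 2, 3, 4, 5, 6, 7, 8] \<and> card B = 4}
        - set (map set [[1, 2, 3, 4], [1, 3, 5, 6], [2, 4, 5, 6], [1, 3, 7, 8], [2, 4, 7, 8]])"
      unfolding Vamos_cube_def by (rule bases_from_nonbases[OF eight]) simp
    from half_plane_and_strong_Rayleigh_paving[OF matroid_Vamos_cube this rayleigh_Vamos_cube]
    show ?thesis unfolding 7 by (simp add: set_eq_subset)
  qed
qed

end
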